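(* Let $n \geq 12$ and $d \geq 3$ be integers, $\delta \in (e^{-n/6}, e^{-2})$ and $P \in \mathcal{P}_d$. Write $s_n = s_n(P)$ and $s_{n/112}^\circ = s_{n/112}^\circ(P)$. (1) Let $\widehat P_n^{\mathrm{ad}}$ be the add-$\widehat\lambda$ estimator with $\widehat\lambda = D_n/d$. With probability at least $1-14\delta$ under $P$, $$\mathrm{KL}(P,\widehat P_n^{\mathrm{ad}}) \leq 121000\, \frac{s_n + s_{n/112}^\circ \log(ed/s_n) + \max\{\log d, \log\log(1/\delta)\}\log(1/\delta)}{n} .$$ (2) Let $\widehat P_{n,\delta}^{\mathrm{ad}}$ be the add-$\widehat\lambda_\delta$ estimator with $\widehat\lambda_\delta = \max\{D_n, \log(1/\delta)\}/d$. With probability at least $1-14\delta$ under $P$, $$\mathrm{KL}(P,\widehat P_{n,\delta}^{\mathrm{ad}}) \leq 121000\, \frac{s_n + s_{n/112}^\circ \log(ed/s_n) + \log(d)\log(1/\delta)}{n} .$$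
   Context: $\mathcal{P}_d$ is the set of probability vectors $P=(p_1,\dots,p_d)$ (with $p_j\ge 0$, $\sum_j p_j=1$), identified with probability distributions on $\{1,\dots,d\}$. $X_1,\dots,X_n$ are i.i.d. with distribution $P$; $N_j=\sum_{i=1}^n \mathbf{1}(X_i=j)$; $D_n=\sum_{j=1}^d \mathbf{1}(N_j\ge 1)$ is the number of distinct classes appearing in the sample. For a (possibly data-dependent) $\lambda>0$, the add-$\lambda$ estimator is the distribution $(\widehat p_1,\dots,\widehat p_d)$ with $\widehat p_j=\frac{N_j+\lambda}{n+\lambda d}$. The effective support size is $s_n(P)=\sum_{j=1}^d \min(np_j,1)$. For real $m>0$, the effective missing support size is $s_m^\circ(P)=\sum_{j=1}^d \min(e^{1-mp_j}, mp_j)=\sum_{j:\,p_j\ge 1/m}e^{1-mp_j}+\sum_{j:\,p_j<1/m} mp_j$. For $P,Q\in\mathcal{P}_d$, $\mathrm{KL}(P,Q)=\sum_{j=1}^d p_j\log(p_j/q_j)\in[0,+\infty]$, with the convention that a term is $0$ if $p_j=0$ and $+\infty$ if $p_j>0=q_j$. $\log$ is the natural logarithm. *)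

theory Defs
  imports "HOL-Probability.Probability"
begin

(* A vector (v_1, ..., v_d) is a function on nat of which only the values on {1..d}
   are used; a sample (x_1, ..., x_n) is likewise a function on nat read on {1..n}. *)

definition prob_vectors :: "nat \<Rightarrow> (nat \<Rightarrow> real) set" where
  "prob_vectors d = {p. (\<forall>j\<in>{1..d}. 0 \<le> p j) \<and> (\<Sum>j=1..d. p j) = 1}"

(* Explicit conventions, because ln 0 = 0 and x / 0 = 0 in HOL. No summand is -\<infinity>. *)
definition KL :: "nat \<Rightarrow> (nat \<Rightarrow> real) \<Rightarrow> (nat \<Rightarrow> real) \<Rightarrow> ereal" where
  "KL d p q = (\<Sum>j=1..d.
     if p j = 0 then 0 else if q j = 0 then \<infinity> else ereal (p j * ln (p j / q j)))"

definition class_count :: "nat \<Rightarrow> (nat \<Rightarrow> nat) \<Rightarrow> nat \<Rightarrow> nat" where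
  "class_count n x j = (\<Sum>i=1..n. of_bool (x i = j))"

definition distinct_classes :: "nat \<Rightarrow> nat \<Rightarrow> (nat \<Rightarrow> nat) \<Rightarrow> nat" where
  "distinct_classes d n x = (\<Sum>j=1..d. of_bool (class_count n x j \<ge> 1))"

definition add_estimator :: "nat \<Rightarrow> nat \<Rightarrow> real \<Rightarrow> (nat \<Rightarrow> nat) \<Rightarrow> nat \<Rightarrow> real" where
  "add_estimator d n lam x j = (real (class_count n x j) + lam) / (real n + lam * real d)"

definition adaptive_estimator :: "nat \<Rightarrow> nat \<Rightarrow> (nat \<Rightarrow> nat) \<Rightarrow> nat \<Rightarrow> real" where
  "adaptive_estimator d n x =
     add_estimator d n (real (distinct_classes d n x) / real d) x"

definition adaptive_conf_estimator :: "nat \<Rightarrow> nat \<Rightarrow> real \<Rightarrow> (nat \<Rightarrow> nat) \<Rightarrow> nat \<Rightarrow> real" where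
  "adaptive_conf_estimator d n \<delta> x =
     add_estimator d n (max (real (distinct_classes d n x)) (ln (1 / \<delta>)) / real d) x"

definition eff_support_size :: "nat \<Rightarrow> nat \<Rightarrow> (nat \<Rightarrow> real) \<Rightarrow> real" where
  "eff_support_size d n p = (\<Sum>j=1..d. min (real n * p j) 1)"

definition eff_missing_support_size :: "nat \<Rightarrow> real \<Rightarrow> (nat \<Rightarrow> real) \<Rightarrow> real" where
  "eff_missing_support_size d m p = (\<Sum>j=1..d. min (exp (1 - m * p j)) (m * p j))"

definition iid_sample ::
  "'a measure \<Rightarrow> nat \<Rightarrow> nat \<Rightarrow> (nat \<Rightarrow> real) \<Rightarrow> (nat \<Rightarrow> 'a \<Rightarrow> nat) \<Rightarrow> bool" where
  "iid_sample M d n p X \<longleftrightarrow>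
     prob_space.indep_vars M (\<lambda>_. count_space {1..d}) X {1..n} \<and>
     (\<forall>i\<in>{1..n}. distributed M (count_space {1..d}) (X i) (\<lambda>j. ennreal (p j)))"

end

theory Submission
  imports Defs
begin

text \<open>
  Write \<open>\<mu>\<^sub>j = n p\<^sub>j\<close>, \<open>L = ln (1/\<delta>)\<close> and \<open>\<Lambda> = d \<lambda>\<close>. Since both vectors sum to one, the divergence is a
  sum of the nonnegative terms \<open>p ln (p/q) - p + q\<close>. Where \<open>N\<^sub>j > \<mu>\<^sub>j/4\<close> such a term is at most
  \<open>(p - q)\<^sup>2/q\<close>, which up to a bias of total order \<open>\<Lambda>/n\<close> is \<open>(N\<^sub>j - \<mu>\<^sub>j)\<^sup>2/(n N\<^sub>j)\<close>; elsewhere it is of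
  order \<open>p\<^sub>j ln (2 \<mu>\<^sub>j d/\<Lambda>)\<close>. The dependence between the counts is harmless because
  \<open>E exp (\<Sum> \<theta>\<^sub>j N\<^sub>j) = (\<Sum> p\<^sub>j exp \<theta>\<^sub>j)\<^sup>n\<close> is at most the value for independent Poisson counts of
  means \<open>\<mu>\<^sub>j\<close>; the same comparison holds for products of nonnegative combinations of
  exponentials, and every statistic needed is dominated by such a product: the chi-square type sum
  by a discretised Gaussian mixture, the number of classes and the sum over underrepresented
  classes by two-point mixtures.
\<close>

section \<open>Restriction of a sample to its index range\<close>

lemma class_count_restrict: "class_count n (restrict x {1..n}) j = class_count n x j"
  unfolding class_count_def by (intro sum.cong) auto

text \<open>Outcomes in the finite model below are extensional functions, while the observed
  sequence is arbitrary off \<open>{1..n}\<close>. This allows passing from one to the other at the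
  very end.\<close>

lemma estimators_restrict:
  "adaptive_estimator d n (restrict x {1..n}) = adaptive_estimator d n x"
  "adaptive_conf_estimator d n \<delta> (restrict x {1..n}) = adaptive_conf_estimator d n \<delta> x"
  unfolding adaptive_estimator_def adaptive_conf_estimator_def add_estimator_def
    distinct_classes_def class_count_restrict by simp_all

section \<open>The finite sample space and the Poisson comparison of exponential moments\<close>

locale discrete_sample =
  fixes n d :: nat and P :: "nat \<Rightarrow> real"
  assumes P: "P \<in> prob_vectors d" and n_pos: "n \<ge> 1"
begin

lemma P_nonneg: "j \<in> {1..d} \<Longrightarrow> 0 \<le> P j"
  and sum_P: "(\<Sum>j=1..d. P j) = 1"
  using P by (auto simp: prob_vectors_def)

text \<open>Extensionality makes the outcomes finitely many and pairwise distinct, so expectations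
  and probabilities become finite weighted sums without measurability conditions.\<close>

definition samples :: "(nat \<Rightarrow> nat) set" where
  "samples = PiE {1..n} (\<lambda>_. {1..d})"

definition weight :: "(nat \<Rightarrow> nat) \<Rightarrow> real" where
  "weight x = (\<Prod>i=1..n. P (x i))"

definition mean :: "((nat \<Rightarrow> nat) \<Rightarrow> real) \<Rightarrow> real" where
  "mean f = (\<Sum>x\<in>samples. weight x * f x)"

definition prob_of :: "((nat \<Rightarrow> nat) \<Rightarrow> bool) \<Rightarrow> real" where
  "prob_of A = mean (\<lambda>x. of_bool (A x))"

lemma finite_samples: "finite samples"
  unfolding samples_def by (intro finite_PiE) auto

lemma samples_in: "x \<in> samples \<Longrightarrow> i \<in> {1..n} \<Longrightarrow> x i \<in> {1..d}"
  unfolding samples_def by auto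

lemma weight_nonneg: "x \<in> samples \<Longrightarrow> 0 \<le> weight x"
  unfolding weight_def by (intro prod_nonneg P_nonneg samples_in) auto

lemma mean_mono: "(\<And>x. x \<in> samples \<Longrightarrow> f x \<le> g x) \<Longrightarrow> mean f \<le> mean g"
  unfolding mean_def by (intro sum_mono mult_left_mono weight_nonneg)

lemma mean_cong: "(\<And>x. x \<in> samples \<Longrightarrow> f x = g x) \<Longrightarrow> mean f = mean g"
  unfolding mean_def by (intro sum.cong) auto

lemma mean_cmult: "mean (\<lambda>x. c * f x) = c * mean f"
  unfolding mean_def sum_distrib_left by (intro sum.cong) auto

lemma mean_sum: "mean (\<lambda>x. \<Sum>i\<in>I. f i x) = (\<Sum>i\<in>I. mean (f i))"
  unfolding mean_def sum_distrib_left by (rule sum.swap)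

lemma mean_add: "mean (\<lambda>x. f x + g x) = mean f + mean g"
  unfolding mean_def by (simp add: distrib_left sum.distrib)

text \<open>Expanding the n-th power of the sum gives one term for each word of length n, which is
  independence in finite form.\<close>

lemma mean_prod: "mean (\<lambda>x. \<Prod>i=1..n. g (x i)) = (\<Sum>j=1..d. P j * g j) ^ n"
proof -
  have "(\<Sum>j=1..d. P j * g j) ^ n = (\<Prod>i=1..n. \<Sum>j\<in>{1..d}. P j * g j)" by simp
  also have "\<dots> = (\<Sum>x\<in>samples. \<Prod>i=1..n. P (x i) * g (x i))"
    unfolding samples_def by (subst prod_sum_PiE) auto
  finally show ?thesis unfolding mean_def weight_def by (simp add: prod.distrib)
qed

lemma mean_one: "mean (\<lambda>_. 1) = 1"
  using mean_prod[of "\<lambda>_. 1"] sum_P by simp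

lemma prob_of_mono: "(\<And>x. x \<in> samples \<Longrightarrow> A x \<Longrightarrow> B x) \<Longrightarrow> prob_of A \<le> prob_of B"
  unfolding prob_of_def by (intro mean_mono) auto

lemma prob_of_disj: "prob_of (\<lambda>x. A x \<or> B x) \<le> prob_of A + prob_of B"
  unfolding prob_of_def mean_add[symmetric] by (intro mean_mono) auto

lemma prob_of_Bex:
  assumes "finite I" shows "prob_of (\<lambda>x. \<exists>i\<in>I. A i x) \<le> (\<Sum>i\<in>I. prob_of (A i))"
  unfolding prob_of_def mean_sum[symmetric]
proof (intro mean_mono)
  fix x
  show "of_bool (\<exists>i\<in>I. A i x) \<le> (\<Sum>i\<in>I. of_bool (A i x) :: real)"
  proof (cases "\<exists>i\<in>I. A i x")
    case True
    then obtain i where i: "i \<in> I" "A i x" by auto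
    have "of_bool (A i x) \<le> (\<Sum>i\<in>I. of_bool (A i x) :: real)"
      using i assms by (intro member_le_sum) auto
    then show ?thesis using i True by auto
  qed (auto simp: sum_nonneg)
qed

lemma prob_of_not: "prob_of A = 1 - prob_of (\<lambda>x. \<not> A x)"
proof -
  have "prob_of A + prob_of (\<lambda>x. \<not> A x) = mean (\<lambda>x. of_bool (A x) + of_bool (\<not> A x))"
    unfolding prob_of_def by (rule mean_add[symmetric])
  also have "\<dots> = mean (\<lambda>_. 1)" by (intro mean_cong) auto
  finally show ?thesis using mean_one by simp
qed

lemma chernoff:
  assumes "mean (\<lambda>x. exp (f x)) \<le> exp b"
  shows "prob_of (\<lambda>x. f x > b + L) \<le> exp (- L)"
proof -
  have "prob_of (\<lambda>x. f x > b + L) \<le> mean (\<lambda>x. exp (- b - L) * exp (f x))"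
    unfolding prob_of_def
  proof (intro mean_mono)
    fix x
    show "of_bool (f x > b + L) \<le> exp (- b - L) * exp (f x)"
      by (auto simp: exp_add[symmetric] not_less[symmetric])
  qed
  also have "\<dots> = exp (- b - L) * mean (\<lambda>x. exp (f x))" by (rule mean_cmult)
  also have "\<dots> \<le> exp (- b - L) * exp b" using assms by (intro mult_left_mono) auto
  also have "\<dots> = exp (- L)" by (simp add: exp_add[symmetric])
  finally show ?thesis .
qed

lemma sum_class_count:
  assumes "x \<in> samples"
  shows "(\<Sum>j=1..d. \<theta> j * real (class_count n x j)) = (\<Sum>i=1..n. \<theta> (x i))"
proof -
  have "(\<Sum>j=1..d. \<theta> j * real (class_count n x j))
      = (\<Sum>j=1..d. \<Sum>i=1..n. \<theta> j * of_bool (x i = j))"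
    unfolding class_count_def of_nat_sum of_nat_of_bool sum_distrib_left by (rule refl)
  also have "\<dots> = (\<Sum>i=1..n. \<Sum>j=1..d. \<theta> j * of_bool (x i = j))" by (rule sum.swap)
  also have "\<dots> = (\<Sum>i=1..n. \<theta> (x i))"
  proof (intro sum.cong refl)
    fix i assume i: "i \<in> {1..n}"
    have "(\<Sum>j=1..d. \<theta> j * of_bool (x i = j)) = (\<Sum>j=1..d. if x i = j then \<theta> j else 0)"
      by (intro sum.cong) auto
    then show "(\<Sum>j=1..d. \<theta> j * of_bool (x i = j)) = \<theta> (x i)"
      using samples_in[OF assms i] by simp
  qed
  finally show ?thesis .
qed

text \<open>As \<open>P\<close> sums to one, the base of the n-th power is 1 + \<Sum> P_j
  (e^\<theta>_j - 1), and 1 + x \<le> e^x turns it into the Poisson moment generating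
  function.\<close>

lemma mean_exp_le:
  "mean (\<lambda>x. exp (\<Sum>j=1..d. \<theta> j * real (class_count n x j)))
    \<le> exp (\<Sum>j=1..d. real n * P j * (exp (\<theta> j) - 1))"
proof -
  have "mean (\<lambda>x. exp (\<Sum>j=1..d. \<theta> j * real (class_count n x j)))
      = mean (\<lambda>x. \<Prod>i=1..n. exp (\<theta> (x i)))"
    by (intro mean_cong) (simp only: sum_class_count exp_sum[OF finite_atLeastAtMost])
  also have "\<dots> = (\<Sum>j=1..d. P j * exp (\<theta> j)) ^ n" by (rule mean_prod)
  also have "\<dots> \<le> exp (\<Sum>j=1..d. P j * (exp (\<theta> j) - 1)) ^ n"
  proof (intro power_mono)
    have "(\<Sum>j=1..d. P j * exp (\<theta> j)) = 1 + (\<Sum>j=1..d. P j * (exp (\<theta> j) - 1))"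
      unfolding right_diff_distrib sum_subtractf mult_1_right sum_P by simp
    then show "(\<Sum>j=1..d. P j * exp (\<theta> j)) \<le> exp (\<Sum>j=1..d. P j * (exp (\<theta> j) - 1))"
      by (metis exp_ge_add_one_self)
    show "0 \<le> (\<Sum>j=1..d. P j * exp (\<theta> j))" by (intro sum_nonneg mult_nonneg_nonneg P_nonneg) auto
  qed
  also have "\<dots> = exp (\<Sum>j=1..d. real n * P j * (exp (\<theta> j) - 1))"
    by (simp add: exp_of_nat_mult[symmetric] sum_distrib_left mult.assoc)
  finally show ?thesis .
qed

text \<open>Multiplying out the product gives a sum over choice functions \<open>g\<close> of single
  exponentials, to each of which \<open>mean_exp_le\<close> applies. Nonnegative coefficients
  preserve the inequality, and the same expansion read backwards restores the product.\<close>

lemma mean_mixture_le: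
  assumes A: "A \<subseteq> {1..d}" and I: "\<And>j. finite (I j)"
    and c: "\<And>j i. j \<in> A \<Longrightarrow> i \<in> I j \<Longrightarrow> 0 \<le> c j i"
  shows "mean (\<lambda>x. \<Prod>j\<in>A. \<Sum>i\<in>I j. c j i * exp (\<theta> j i * real (class_count n x j)))
    \<le> (\<Prod>j\<in>A. \<Sum>i\<in>I j. c j i * exp (real n * P j * (exp (\<theta> j i) - 1)))"
proof -
  have fin: "finite A" using A finite_subset by blast
  have "mean (\<lambda>x. \<Prod>j\<in>A. \<Sum>i\<in>I j. c j i * exp (\<theta> j i * real (class_count n x j)))
     = mean (\<lambda>x. \<Sum>g\<in>PiE A I. \<Prod>j\<in>A. c j (g j) * exp (\<theta> j (g j) * real (class_count n x j)))"
    using fin I by (intro mean_cong prod_sum_PiE) auto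
  also have "\<dots> = (\<Sum>g\<in>PiE A I. mean (\<lambda>x. \<Prod>j\<in>A. c j (g j) * exp (\<theta> j (g j) * real (class_count n x j))))"
    by (rule mean_sum)
  also have "\<dots> \<le> (\<Sum>g\<in>PiE A I. \<Prod>j\<in>A. c j (g j) * exp (real n * P j * (exp (\<theta> j (g j)) - 1)))"
  proof (intro sum_mono)
    fix g assume g: "g \<in> PiE A I"
    \<comment> \<open>Outside \<open>A\<close> the exponent 0 contributes nothing on either side,
      since e^0 - 1 = 0.\<close>
    define \<eta> where "\<eta> = (\<lambda>j. if j \<in> A then \<theta> j (g j) else 0)"
    have sumA: "(\<Sum>j=1..d. f j) = (\<Sum>j\<in>A. f j)" if "\<And>j. j \<notin> A \<Longrightarrow> f j = 0" for f :: "nat \<Rightarrow> real"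
      using A that by (intro sum.mono_neutral_right) auto
    have 1: "(\<Prod>j\<in>A. c j (g j) * exp (\<theta> j (g j) * real (class_count n x j)))
      = (\<Prod>j\<in>A. c j (g j)) * exp (\<Sum>j=1..d. \<eta> j * real (class_count n x j))" for x
      by (subst sumA) (auto simp: \<eta>_def prod.distrib exp_sum[OF fin])
    have 2: "(\<Prod>j\<in>A. c j (g j) * exp (real n * P j * (exp (\<theta> j (g j)) - 1)))
      = (\<Prod>j\<in>A. c j (g j)) * exp (\<Sum>j=1..d. real n * P j * (exp (\<eta> j) - 1))"
      by (subst sumA) (auto simp: \<eta>_def prod.distrib exp_sum[OF fin])
    show "mean (\<lambda>x. \<Prod>j\<in>A. c j (g j) * exp (\<theta> j (g j) * real (class_count n x j)))
      \<le> (\<Prod>j\<in>A. c j (g j) * exp (real n * P j * (exp (\<theta> j (g j)) - 1)))"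
      unfolding 1 2 mean_cmult using g
      by (intro mult_left_mono mean_exp_le prod_nonneg c) auto
  qed
  also have "\<dots> = (\<Prod>j\<in>A. \<Sum>i\<in>I j. c j i * exp (real n * P j * (exp (\<theta> j i) - 1)))"
    using fin I by (intro prod_sum_PiE[symmetric]) auto
  finally show ?thesis .
qed

end

section \<open>Exponential inequalities and the Gaussian mixture dominating the chi-square
  term\<close>

lemma exp_le_quadratic:
  fixes x :: real
  assumes "\<bar>x\<bar> \<le> 1" shows "exp x \<le> 1 + x + x\<^sup>2"
proof (cases "x \<ge> 0")
  case True then show ?thesis using exp_bound[of x] assms by auto
next
  case False
  define y where "y = - x"
  have y: "0 \<le> y" "x = - y" using False by (auto simp: y_def)
  \<comment> \<open>For negative arguments the claim is 1 \<le> (1 - y + y^2) e^y, and the Taylor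
    polynomial may replace e^y because the first factor is positive.\<close>
  have "1 \<le> (1 - y + y\<^sup>2) * (1 + y + y\<^sup>2 / 2)"
  proof -
    have "(1 - y + y\<^sup>2) * (1 + y + y\<^sup>2 / 2) = 1 + (y^2 + y^3 + y^4) / 2"
      by (simp add: field_simps power2_eq_square power3_eq_cube power4_eq_xxxx)
    then show ?thesis using y by simp
  qed
  also have "\<dots> \<le> (1 - y + y\<^sup>2) * exp y"
  proof (intro mult_left_mono exp_lower_Taylor_quadratic y)
    have "1 - y + y\<^sup>2 = (y - 1/2)\<^sup>2 + 3/4" by (simp add: power2_eq_square algebra_simps)
    then show "0 \<le> 1 - y + y\<^sup>2" by simp
  qed
  finally show ?thesis unfolding y(2) by (simp add: exp_minus field_simps)
qed

lemma exp_minus_1_le: "exp (- 1 :: real) \<le> 3 / 8"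
proof -
  \<comment> \<open>The number 41/32 = 1 + 1/4 + 1/32 is the quadratic Taylor polynomial of exp at
    1/4.\<close>
  have "(8 / 3 :: real) \<le> (41 / 32) ^ 4" by (simp add: power_divide)
  also have "\<dots> \<le> exp (1 / 4) ^ 4"
    using exp_lower_Taylor_quadratic[of "1/4::real"]
    by (intro power_mono) (auto simp: power2_eq_square)
  also have "\<dots> = exp 1" by (simp add: exp_of_nat_mult[symmetric])
  finally have "(8 / 3 :: real) \<le> exp 1" .
  then show ?thesis by (simp add: exp_minus field_simps)
qed

text \<open>A chi-square term normalised by the observed count. It is cut off where the count is far
  below its mean, because the quotient explodes there; those classes are treated by their logarithm
  instead.\<close>

definition chi2 :: "real \<Rightarrow> real \<Rightarrow> real" where
  "chi2 \<mu> k = (if k > \<mu> / 4 then (k - \<mu>)\<^sup>2 / k else 0)"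

text \<open>With \<theta> = \<sigma> i / sqrt \<mu>, the expression \<theta> k - \<mu> (e^\<theta> -
  1) is the logarithm of a Poisson likelihood ratio, whose exponential has mean one. Some tilt on
  this grid nearly maximises it and then beats the chi-square term. The part 3/2 - i is the
  logarithm of a summable mixture weight.\<close>

lemma chi2_le_exponent:
  assumes \<mu>: "\<mu> \<ge> 1" and k: "k \<ge> 0"
  shows "\<exists>i \<sigma>. i \<le> nat \<lfloor>sqrt \<mu>\<rfloor> \<and> \<sigma> \<in> {- 1, 1} \<and>
    chi2 \<mu> k / 32 \<le> 3/2 - real i - \<mu> * (exp (\<sigma> * real i / sqrt \<mu>) - 1) + \<sigma> * real i / sqrt \<mu> * k"
proof -
  define r where "r = sqrt \<mu>"
  have r: "r \<ge> 1" "\<mu> = r\<^sup>2" using \<mu> by (auto simp: r_def)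
  \<comment> \<open>The restriction i \<le> r keeps the tilt in [-1, 1], where
    \<open>exp_le_quadratic\<close> applies; its quadratic part contributes \<mu> \<theta>^2 =
    i^2.\<close>
  have key: "chi2 \<mu> k / 32 \<le> 3/2 - real i - \<mu> * (exp (\<sigma> * real i / r) - 1) + \<sigma> * real i / r * k"
    if i: "real i \<le> r" and \<sigma>: "\<sigma> \<in> {- 1, 1}"
      and le: "chi2 \<mu> k / 32 \<le> 3/2 - real i + \<sigma> * real i * (k - \<mu>) / r - (real i)\<^sup>2" for i \<sigma>
  proof -
    have "exp (\<sigma> * real i / r) \<le> 1 + \<sigma> * real i / r + (\<sigma> * real i / r)\<^sup>2"
      using i r \<sigma> by (intro exp_le_quadratic) (auto simp: abs_mult)
    then have "\<mu> * (exp (\<sigma> * real i / r) - 1) \<le> \<mu> * (\<sigma> * real i / r + (\<sigma> * real i / r)\<^sup>2)"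
      using \<mu> by (intro mult_left_mono) auto
    also have "\<dots> = \<mu> * (\<sigma> * real i / r) + (real i)\<^sup>2"
      using \<sigma> r by (auto simp: r(2) field_simps power2_eq_square)
    finally show ?thesis using le by (simp add: algebra_simps diff_divide_distrib)
  qed
  have "\<exists>i \<sigma>. real i \<le> r \<and> \<sigma> \<in> {- 1, 1} \<and>
      chi2 \<mu> k / 32 \<le> 3/2 - real i + \<sigma> * real i * (k - \<mu>) / r - (real i)\<^sup>2"
  proof -
    consider "k \<le> \<mu> / 4" | "\<mu> / 4 < k" "k \<le> 3 * \<mu>" | "k > 3 * \<mu>" by linarith
    then show ?thesis
    proof cases
      case 1
      then show ?thesis using r by (intro exI[of _ 0] exI[of _ 1]) (auto simp: chi2_def)
    next
      case 2
      \<comment> \<open>The gain 2 u i - i^2 is maximal at i = u, so \<open>i\<close> is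
        \<open>u\<close> rounded down. As \<mu> / k < 4, only u^2 / 2 is needed, and the other half
        of the gain u^2 together with 3/2 pays for the weight and the rounding.\<close>
      define u where "u = \<bar>k - \<mu>\<bar> / (2 * r)"
      define \<sigma> :: real where "\<sigma> = (if k \<ge> \<mu> then 1 else - 1)"
      define i where "i = nat \<lfloor>u\<rfloor>"
      have u0: "u \<ge> 0" using r by (auto simp: u_def)
      have "\<bar>k - \<mu>\<bar> \<le> 2 * r\<^sup>2" using 2 r(2) \<mu> by (auto simp: abs_if)
      then have ur: "u \<le> r" using r(1) by (auto simp: u_def field_simps power2_eq_square)
      have i: "real i \<le> u" "u < real i + 1" using u0 by (auto simp: i_def)
      have su: "\<sigma> * (k - \<mu>) / r = 2 * u" using r by (auto simp: \<sigma>_def u_def field_simps)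
      have "(k - \<mu>)\<^sup>2 = 4 * u\<^sup>2 * \<mu>"
        using r by (auto simp: u_def power_divide power_mult_distrib)
      then have "chi2 \<mu> k / 32 = u\<^sup>2 / 8 * (\<mu> / k)" using 2 by (simp add: chi2_def)
      also have "\<dots> \<le> u\<^sup>2 / 8 * 4"
        using 2 \<mu> by (intro mult_left_mono) (auto simp: field_simps)
      also have "\<dots> \<le> 3/2 - real i + real i * (2 * u) - (real i)\<^sup>2"
      proof -
        define f where "f = u - real i"
        have f: "0 \<le> f" "f \<le> 1" "u = real i + f" using i by (auto simp: f_def)
        have "f\<^sup>2 \<le> 1" using f by (simp add: power_le_one)
        moreover have "0 \<le> real i * f" "0 \<le> (real i - 1)\<^sup>2" using f by auto
        ultimately have "0 \<le> (1 - f\<^sup>2) / 2 + real i * f + (real i - 1)\<^sup>2 / 2 + 1/2" by simp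
        also have "\<dots> = 3/2 - real i + real i * (2 * u) - (real i)\<^sup>2 - u\<^sup>2 / 8 * 4"
          unfolding f(3) by (simp add: field_simps power2_eq_square)
        finally show ?thesis by simp
      qed
      also have "real i * (2 * u) = \<sigma> * real i * (k - \<mu>) / r" unfolding su[symmetric] by simp
      finally show ?thesis using i ur by (intro exI[of _ i] exI[of _ \<sigma>]) (auto simp: \<sigma>_def)
    next
      case 3
      \<comment> \<open>Here the maximiser exceeds \<open>r\<close>, so the largest admissible tilt
        is taken, which satisfies i / r \<ge> 1/2. It suffices because the chi-square term now grows
        at most linearly in \<open>k\<close>.\<close>
      define i where "i = nat \<lfloor>r\<rfloor>"
      have "real i = real_of_int \<lfloor>r\<rfloor>" "1 \<le> \<lfloor>r\<rfloor>" using r by (auto simp: i_def le_floor_iff)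
      then have i: "real i \<le> r" "r \<le> 2 * real i" by linarith+
      have "(k - \<mu>)\<^sup>2 / k \<le> k - \<mu>"
        using 3 \<mu> by (auto simp: field_simps power2_eq_square)
      then have "chi2 \<mu> k / 32 \<le> (k - \<mu>) / 32" using 3 \<mu> by (auto simp: chi2_def)
      also have "\<dots> \<le> 3/2 - r + 1 / 2 * (k - 2 * \<mu>)"
      proof -
        \<comment> \<open>The inequality to prove has slope 1/32 in \<open>k\<close> on the left and
          1/2 on the right, so k = 3 \<mu> is the critical point; there it reads r \<le> 3/2 + 7/16
          r^2.\<close>
        have "0 \<le> 7 / 16 * (r - 8/7)\<^sup>2" by simp
        then have "r \<le> 4/7 + 7/16 * r\<^sup>2" by (simp add: power2_eq_square algebra_simps)
        then show ?thesis using 3 unfolding r(2) by argo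
      qed
      also have "1 / 2 * (k - 2 * \<mu>) \<le> real i / r * (k - 2 * \<mu>)"
        using i r 3 \<mu> by (intro mult_right_mono) (simp add: field_simps, linarith)
      also have "real i / r * (k - 2 * \<mu>) \<le> real i / r * (k - \<mu> - real i * r)"
        using i r by (intro mult_left_mono) (auto simp: power2_eq_square)
      also have "\<dots> = 1 * real i * (k - \<mu>) / r - (real i)\<^sup>2"
        using r by (auto simp: field_simps power2_eq_square)
      finally show ?thesis using i by (intro exI[of _ i] exI[of _ 1]) auto
    qed
  qed
  then obtain i \<sigma> where "real i \<le> r" "\<sigma> \<in> {- 1, 1}"
      "chi2 \<mu> k / 32 \<le> 3/2 - real i + \<sigma> * real i * (k - \<mu>) / r - (real i)\<^sup>2" by blast
  moreover have "i \<le> nat \<lfloor>sqrt \<mu>\<rfloor>" using \<open>real i \<le> r\<close> by (simp add: r_def le_nat_floor)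
  ultimately show ?thesis using key[of i \<sigma>] unfolding r_def by blast
qed

lemma exp_chi2_le_mixture:
  assumes \<mu>: "\<mu> \<ge> 1" and k: "k \<ge> 0"
  shows "exp (chi2 \<mu> k / 32) \<le> (\<Sum>(i, \<sigma>)\<in>{..nat \<lfloor>sqrt \<mu>\<rfloor>} \<times> {- 1, 1}.
    exp (3/2 - real i - \<mu> * (exp (\<sigma> * real i / sqrt \<mu>) - 1)) * exp (\<sigma> * real i / sqrt \<mu> * k))"
proof -
  obtain i \<sigma> where i: "(i, \<sigma>) \<in> {..nat \<lfloor>sqrt \<mu>\<rfloor>} \<times> {- 1, 1}"
    and le: "chi2 \<mu> k / 32 \<le> 3/2 - real i - \<mu> * (exp (\<sigma> * real i / sqrt \<mu>) - 1) + \<sigma> * real i / sqrt \<mu> * k"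
    using chi2_le_exponent[OF assms] by auto
  let ?f = "\<lambda>(i, \<sigma>). exp (3/2 - real i - \<mu> * (exp (\<sigma> * real i / sqrt \<mu>) - 1)) * exp (\<sigma> * real i / sqrt \<mu> * k)"
  have "exp (chi2 \<mu> k / 32) \<le> ?f (i, \<sigma>)" using le by (simp add: exp_add[symmetric])
  also have "\<dots> \<le> sum ?f ({..nat \<lfloor>sqrt \<mu>\<rfloor>} \<times> {- 1, 1})"
    using i by (intro member_le_sum) auto
  finally show ?thesis .
qed

text \<open>These are the weights left once the Poisson expectation has cancelled the normalising
  factors. Both signs and a geometric series of ratio 1/2 give at most 4 e^(3/2).\<close>

lemma sum_mixture_weights:
  "(\<Sum>(i, \<sigma> :: real)\<in>{..K::nat} \<times> {- 1, 1}. exp (3/2 - real i)) \<le> exp (3 :: real)"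
proof -
  have "(\<Sum>(i, \<sigma> :: real)\<in>{..K} \<times> {- 1, 1}. exp (3/2 - real i)) = 2 * (\<Sum>i\<le>K. exp (3/2 - real i))"
    by (simp add: sum.cartesian_product[symmetric] sum_distrib_left)
  also have "(\<Sum>i\<le>K. exp (3/2 - real i)) \<le> (\<Sum>i\<le>K. exp (3/2) * (1/2)^i)"
  proof (intro sum_mono)
    fix i
    have "exp (- real i) = exp (- 1) ^ i" by (simp add: exp_of_nat_mult[symmetric])
    also have "\<dots> \<le> (1/2) ^ i" using exp_minus_1_le by (intro power_mono) auto
    finally have "exp (3/2) * exp (- real i) \<le> exp (3/2) * (1/2) ^ i" by (intro mult_left_mono) auto
    then show "exp (3/2 - real i) \<le> exp (3/2) * (1/2) ^ i" unfolding exp_add[symmetric] by simp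
  qed
  also have "\<dots> = exp (3/2) * (\<Sum>i\<le>K. (1/2)^i)" by (simp add: sum_distrib_left)
  also have "(\<Sum>i\<le>K. (1/2)^i) \<le> (2 :: real)"
    by (subst sum_gp0) (auto simp: field_simps)
  also have "2 * (exp (3/2) * 2) = exp (3/2) * (2 * 2 :: real)" by simp
  \<comment> \<open>The factor 2 is at most 1 + 3/4 + 9/32, hence at most e^(3/4).\<close>
  also have "\<dots> \<le> exp (3/2) * (exp (3/4) * exp (3/4))"
    using exp_lower_Taylor_quadratic[of "3/4::real"]
    by (intro mult_left_mono mult_mono) (auto simp: power2_eq_square)
  finally show ?thesis by (simp add: exp_add[symmetric])
qed

text \<open>The rate 5/8 is the lower bound for 1 - e^(-1), and 5/13 is the value of 1 - 1 / (1 +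
  5/8 y) at y = 1, a chord slope by concavity.\<close>

lemma one_minus_exp_ge: "y \<ge> 0 \<Longrightarrow> 1 - exp (- 5/8 * y) \<ge> 5/13 * min y (1::real)"
proof -
  assume y: "y \<ge> 0"
  have "exp (- 5/8 * y) \<le> 1 / (1 + 5/8 * y)"
    using exp_ge_add_one_self[of "5/8 * y"] y by (simp add: exp_minus field_simps)
  also have "\<dots> \<le> 1 - 5/13 * min y 1"
  proof (cases "y \<le> 1")
    case True
    have "1 \<le> (1 - 5/13 * y) * (1 + 5/8 * y)"
      using True y mult_mono[of y 1 y y] by (simp add: algebra_simps)
    then show ?thesis using True y by (simp add: divide_le_eq)
  next
    case False then show ?thesis by (simp add: field_simps)
  qed
  finally show ?thesis by linarith
qed

section \<open>Deviation bounds for the sample statistics\<close>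

context discrete_sample
begin

abbreviation \<mu> :: "nat \<Rightarrow> real" where "\<mu> j \<equiv> real n * P j"

abbreviation N :: "(nat \<Rightarrow> nat) \<Rightarrow> nat \<Rightarrow> real" where "N x j \<equiv> real (class_count n x j)"

lemma \<mu>_nonneg: "j \<in> {1..d} \<Longrightarrow> 0 \<le> \<mu> j" using P_nonneg by simp

text \<open>Each factor is dominated by its mixture. Under the Poisson comparison every component
  integrates to its weight, so each class costs a factor of at most e^3.\<close>

lemma chi2_deviation:
  assumes H: "H \<subseteq> {1..d}" "\<And>j. j \<in> H \<Longrightarrow> \<mu> j \<ge> 1"
  shows "prob_of (\<lambda>x. (\<Sum>j\<in>H. chi2 (\<mu> j) (N x j)) / 32 > 3 * real (card H) + L) \<le> exp (- L)"
proof (rule chernoff)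
  have fin: "finite H" using H finite_subset by blast
  define I where "I = (\<lambda>j. {..nat \<lfloor>sqrt (\<mu> j)\<rfloor>} \<times> {- 1, 1 :: real})"
  define \<theta> where "\<theta> = (\<lambda>j (i :: nat, \<sigma>). \<sigma> * real i / sqrt (\<mu> j))"
  define c where "c = (\<lambda>j (i :: nat, \<sigma>). exp (3/2 - real i - \<mu> j * (exp (\<sigma> * real i / sqrt (\<mu> j)) - 1)))"
  have "mean (\<lambda>x. exp ((\<Sum>j\<in>H. chi2 (\<mu> j) (N x j)) / 32))
     \<le> mean (\<lambda>x. \<Prod>j\<in>H. \<Sum>i\<in>I j. c j i * exp (\<theta> j i * N x j))"
  proof (intro mean_mono)
    fix x
    have "exp ((\<Sum>j\<in>H. chi2 (\<mu> j) (N x j)) / 32) = (\<Prod>j\<in>H. exp (chi2 (\<mu> j) (N x j) / 32))"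
      by (simp add: sum_divide_distrib exp_sum[OF fin])
    also have "\<dots> \<le> (\<Prod>j\<in>H. \<Sum>i\<in>I j. c j i * exp (\<theta> j i * N x j))"
      using exp_chi2_le_mixture[OF H(2)] by (intro prod_mono) (auto simp: I_def c_def \<theta>_def case_prod_unfold)
    finally show "exp ((\<Sum>j\<in>H. chi2 (\<mu> j) (N x j)) / 32) \<le> \<dots>" .
  qed
  also have "\<dots> \<le> (\<Prod>j\<in>H. \<Sum>i\<in>I j. c j i * exp (\<mu> j * (exp (\<theta> j i) - 1)))"
    by (intro mean_mixture_le H) (auto simp: I_def c_def)
  also have "\<dots> = (\<Prod>j\<in>H. \<Sum>(i, \<sigma>)\<in>I j. exp (3/2 - real i))"
    by (intro prod.cong sum.cong refl) (auto simp: c_def \<theta>_def exp_add[symmetric])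
  also have "\<dots> \<le> (\<Prod>j\<in>H. exp 3)"
    unfolding I_def by (intro prod_mono conjI sum_mixture_weights sum_nonneg) auto
  also have "\<dots> = exp (3 * real (card H))" by (simp add: exp_of_nat2_mult)
  finally show "mean (\<lambda>x. exp ((\<Sum>j\<in>H. chi2 (\<mu> j) (N x j)) / 32)) \<le> exp (3 * real (card H))" .
qed

lemma count_deviation:
  assumes J: "J \<subseteq> {1..d}"
  shows "prob_of (\<lambda>x. (\<Sum>j\<in>J. N x j) > 2 * (\<Sum>j\<in>J. \<mu> j) + L) \<le> exp (- L)"
proof (rule chernoff)
  define \<theta> :: "nat \<Rightarrow> real" where "\<theta> = (\<lambda>j. of_bool (j \<in> J))"
  have sumJ: "(\<Sum>j=1..d. f j) = (\<Sum>j\<in>J. f j)" if "\<And>j. j \<notin> J \<Longrightarrow> f j = 0" for f :: "nat \<Rightarrow> real"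
    using J that by (intro sum.mono_neutral_right) auto
  have "mean (\<lambda>x. exp (\<Sum>j\<in>J. N x j)) = mean (\<lambda>x. exp (\<Sum>j=1..d. \<theta> j * N x j))"
    by (subst sumJ) (auto simp: \<theta>_def)
  also have "\<dots> \<le> exp (\<Sum>j=1..d. \<mu> j * (exp (\<theta> j) - 1))" by (rule mean_exp_le)
  also have "(\<Sum>j=1..d. \<mu> j * (exp (\<theta> j) - 1)) = (\<Sum>j\<in>J. \<mu> j * (exp 1 - 1))"
    by (subst sumJ) (auto simp: \<theta>_def)
  also have "\<dots> \<le> (\<Sum>j\<in>J. \<mu> j * 2)"
    using exp_le J P_nonneg by (intro sum_mono mult_left_mono) auto
  finally show "mean (\<lambda>x. exp (\<Sum>j\<in>J. N x j)) \<le> exp (2 * (\<Sum>j\<in>J. \<mu> j))"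
    by (simp add: sum_distrib_left mult.commute mult.left_commute)
qed

abbreviation s :: real where "s \<equiv> eff_support_size d n P"

text \<open>The indicator factor is dominated by e^(-1) + (1 - e^(-1)) e^(-N), with equality at N =
  0. The constant is 25/104 = 5/8 * 5/13.\<close>

lemma distinct_classes_lower:
  "prob_of (\<lambda>x. - real (distinct_classes d n x) > - (25/104) * s + L) \<le> exp (- L)"
proof (rule chernoff)
  define c :: "nat \<Rightarrow> nat \<Rightarrow> real" where "c = (\<lambda>_ i. if i = 0 then exp (- 1) else 1 - exp (- 1))"
  define \<theta> :: "nat \<Rightarrow> nat \<Rightarrow> real" where "\<theta> = (\<lambda>_ i. - real i)"
  have "mean (\<lambda>x. exp (- real (distinct_classes d n x)))
     \<le> mean (\<lambda>x. \<Prod>j=1..d. \<Sum>i\<in>{0,1}. c j i * exp (\<theta> j i * N x j))"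
  proof (intro mean_mono)
    fix x
    have "exp (- real (distinct_classes d n x)) = (\<Prod>j=1..d. exp (- of_bool (class_count n x j \<ge> 1)))"
      unfolding distinct_classes_def of_nat_sum of_nat_of_bool sum_negf[symmetric]
      by (rule exp_sum) simp
    also have "\<dots> \<le> (\<Prod>j=1..d. \<Sum>i\<in>{0,1}. c j i * exp (\<theta> j i * N x j))"
      by (intro prod_mono) (auto simp: c_def \<theta>_def Suc_le_eq)
    finally show "exp (- real (distinct_classes d n x)) \<le> \<dots>" .
  qed
  also have "\<dots> \<le> (\<Prod>j=1..d. \<Sum>i\<in>{0,1}. c j i * exp (\<mu> j * (exp (\<theta> j i) - 1)))"
    by (intro mean_mixture_le) (auto simp: c_def)
  also have "\<dots> \<le> (\<Prod>j=1..d. exp (- (25/104) * min (\<mu> j) 1))"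
  proof (intro prod_mono conjI sum_nonneg)
    fix j assume j: "j \<in> {1..d}"
    have m: "\<mu> j \<ge> 0" using \<mu>_nonneg j by simp
    have "\<mu> j * (exp (- 1) - 1) \<le> \<mu> j * (- 5/8)"
      using exp_minus_1_le m by (intro mult_left_mono) auto
    then have "exp (\<mu> j * (exp (- 1) - 1)) \<le> exp (- 5/8 * \<mu> j)" by (simp add: mult.commute)
    also have "\<dots> \<le> 1 - 5/13 * min (\<mu> j) 1" using one_minus_exp_ge[OF m] by linarith
    finally have "(1 - exp (- 1)) * exp (\<mu> j * (exp (- 1) - 1)) \<le> (1 - exp (- 1)) * (1 - 5/13 * min (\<mu> j) 1)"
      by (intro mult_left_mono) auto
    then have "exp (- 1) + (1 - exp (- 1)) * exp (\<mu> j * (exp (- 1) - 1)) \<le> 1 - (1 - exp (- 1)) * (5/13 * min (\<mu> j) 1)"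
      by (simp add: algebra_simps)
    also have "\<dots> \<le> 1 - 5/8 * (5/13 * min (\<mu> j) 1)"
      using exp_minus_1_le m mult_right_mono[of "5/8" "1 - exp (- 1)" "5/13 * min (\<mu> j) 1"] by simp
    also have "\<dots> \<le> exp (- (25/104) * min (\<mu> j) 1)"
      using exp_ge_add_one_self[of "- (25/104) * min (\<mu> j) 1"] by simp
    finally show "(\<Sum>i\<in>{0,1}. c j i * exp (\<mu> j * (exp (\<theta> j i) - 1))) \<le> exp (- (25/104) * min (\<mu> j) 1)"
      by (simp add: c_def \<theta>_def)
  qed (auto simp: c_def)
  also have "\<dots> = exp (- (25/104) * s)"
    unfolding eff_support_size_def sum_distrib_left by (rule exp_sum[symmetric]) simp
  finally show "mean (\<lambda>x. exp (- real (distinct_classes d n x))) \<le> exp (- (25/104) * s)" .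
qed

text \<open>Exactly the classes on which \<open>chi2\<close> is cut off to zero.\<close>

definition bad :: "(nat \<Rightarrow> nat) \<Rightarrow> nat \<Rightarrow> bool" where
  "bad x j \<longleftrightarrow> N x j \<le> \<mu> j / 4"

lemma of_bool_bad_le: "of_bool (bad x j) \<le> exp (\<mu> j / 4) * exp (- N x j)"
  by (auto simp: bad_def exp_add[symmetric])

lemma exp_exponent_bad: "j \<in> {1..d} \<Longrightarrow> exp (\<mu> j / 4) * exp (\<mu> j * (exp (- 1) - 1)) \<le> exp (- 3/8 * \<mu> j)"
  using mult_left_mono[OF exp_minus_1_le \<mu>_nonneg[of j]]
  by (simp add: exp_add[symmetric] algebra_simps)

text \<open>The Poisson comparison bounds the chance of \<open>bad\<close> by e^(-3/8 \<mu>), see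
  \<open>exp_exponent_bad\<close>. The condition on \<open>t\<close> lets the tilt use half of this
  decay, through e^y - 1 \<le> y e^y with y \<le> 3/16 \<mu>, and the other half remains in the
  centring term.\<close>

lemma weighted_bad_deviation:
  assumes A: "A \<subseteq> {1..d}" and t: "t > 0"
    and a: "\<And>j. j \<in> A \<Longrightarrow> 0 \<le> a j" "\<And>j. j \<in> A \<Longrightarrow> t * a j \<le> 3/16 * \<mu> j"
  shows "prob_of (\<lambda>x. (\<Sum>j\<in>A. a j * of_bool (bad x j)) > (\<Sum>j\<in>A. a j * exp (- 3/16 * \<mu> j)) + L / t) \<le> exp (- L)"
proof -
  have fin: "finite A" using A finite_subset by blast
  let ?b = "\<Sum>j\<in>A. a j * exp (- 3/16 * \<mu> j)"
  define c :: "nat \<Rightarrow> nat \<Rightarrow> real" where "c = (\<lambda>j i. if i = 0 then 1 else (exp (t * a j) - 1) * exp (\<mu> j / 4))"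
  define \<theta> :: "nat \<Rightarrow> nat \<Rightarrow> real" where "\<theta> = (\<lambda>_ i. - real i)"
  have c0: "0 \<le> c j i" if "j \<in> A" for i j using a(1)[OF that] t by (auto simp: c_def)
  have "mean (\<lambda>x. exp (t * (\<Sum>j\<in>A. a j * of_bool (bad x j))))
     \<le> mean (\<lambda>x. \<Prod>j\<in>A. \<Sum>i\<in>{0,1}. c j i * exp (\<theta> j i * N x j))"
  proof (intro mean_mono)
    fix x
    have "exp (t * (\<Sum>j\<in>A. a j * of_bool (bad x j))) = (\<Prod>j\<in>A. exp (t * (a j * of_bool (bad x j))))"
      by (simp only: sum_distrib_left exp_sum[OF fin])
    also have "\<dots> \<le> (\<Prod>j\<in>A. \<Sum>i\<in>{0,1}. c j i * exp (\<theta> j i * N x j))"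
    proof (intro prod_mono conjI)
      fix j assume j: "j \<in> A"
      have "exp (t * (a j * of_bool (bad x j))) = 1 + (exp (t * a j) - 1) * of_bool (bad x j)" by auto
      also have "\<dots> \<le> 1 + (exp (t * a j) - 1) * (exp (\<mu> j / 4) * exp (- N x j))"
        using a(1)[OF j] t by (intro add_left_mono mult_left_mono of_bool_bad_le) auto
      finally show "exp (t * (a j * of_bool (bad x j))) \<le> (\<Sum>i\<in>{0,1}. c j i * exp (\<theta> j i * N x j))"
        by (simp add: c_def \<theta>_def)
    qed auto
    finally show "exp (t * (\<Sum>j\<in>A. a j * of_bool (bad x j))) \<le> \<dots>" .
  qed
  also have "\<dots> \<le> (\<Prod>j\<in>A. \<Sum>i\<in>{0,1}. c j i * exp (\<mu> j * (exp (\<theta> j i) - 1)))"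
    using c0 A by (intro mean_mixture_le) auto
  also have "\<dots> \<le> (\<Prod>j\<in>A. exp (t * (a j * exp (- 3/16 * \<mu> j))))"
  proof (intro prod_mono conjI sum_nonneg)
    fix j assume j: "j \<in> A"
    define y where "y = t * a j"
    have y: "0 \<le> y" "y \<le> 3/16 * \<mu> j" using a j t by (auto simp: y_def)
    have "(1 - y) * exp y \<le> exp (- y) * exp y"
      using exp_ge_add_one_self[of "- y"] by (intro mult_right_mono) auto
    then have "exp y - 1 \<le> y * exp y" by (simp add: exp_add[symmetric] algebra_simps)
    also have "\<dots> \<le> y * exp (3/16 * \<mu> j)" using y by (intro mult_left_mono) auto
    finally have "(exp y - 1) * (exp (\<mu> j / 4) * exp (\<mu> j * (exp (- 1) - 1)))
        \<le> (y * exp (3/16 * \<mu> j)) * exp (- 3/8 * \<mu> j)"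
      using y j A by (intro mult_mono exp_exponent_bad) auto
    also have "\<dots> = y * exp (- 3/16 * \<mu> j)" by (simp add: exp_add[symmetric] mult.assoc)
    finally have "1 + (exp y - 1) * (exp (\<mu> j / 4) * exp (\<mu> j * (exp (- 1) - 1))) \<le> 1 + y * exp (- 3/16 * \<mu> j)"
      by simp
    also have "\<dots> \<le> exp (y * exp (- 3/16 * \<mu> j))" by (rule exp_ge_add_one_self)
    finally show "(\<Sum>i\<in>{0,1}. c j i * exp (\<mu> j * (exp (\<theta> j i) - 1))) \<le> exp (t * (a j * exp (- 3/16 * \<mu> j)))"
      by (simp add: c_def \<theta>_def y_def mult.assoc)
  qed (use c0 in auto)
  also have "\<dots> = exp (t * ?b)"
    by (simp add: sum_distrib_left exp_sum[OF fin])
  finally have "prob_of (\<lambda>x. t * (\<Sum>j\<in>A. a j * of_bool (bad x j)) > t * ?b + L) \<le> exp (- L)" by (rule chernoff)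
  also have "(\<lambda>x. t * (\<Sum>j\<in>A. a j * of_bool (bad x j)) > t * ?b + L)
    = (\<lambda>x. (\<Sum>j\<in>A. a j * of_bool (bad x j)) > ?b + L / t)"
    using t by (auto simp: field_simps fun_eq_iff)
  finally show ?thesis .
qed

text \<open>A union bound over at most d classes: above the threshold 3/8 \<mu> exceeds L + ln d, so
  each class fails with probability at most e^(-L) / d. On the remaining classes \<mu> is bounded
  and so are the logarithms.\<close>

lemma bad_large:
  assumes L: "L \<ge> 0" and d: "d \<ge> 1"
  shows "prob_of (\<lambda>x. \<exists>j\<in>{j \<in> {1..d}. \<mu> j > 3 * (L + ln (real d))}. bad x j) \<le> exp (- L)"
proof -
  let ?A = "{j \<in> {1..d}. \<mu> j > 3 * (L + ln (real d))}"
  have "prob_of (\<lambda>x. \<exists>j\<in>?A. bad x j) \<le> (\<Sum>j\<in>?A. prob_of (\<lambda>x. bad x j))" by (intro prob_of_Bex) auto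
  also have "\<dots> \<le> (\<Sum>j\<in>?A. exp (- L) / real d)"
  proof (intro sum_mono)
    fix j assume j: "j \<in> ?A"
    \<comment> \<open>The single exponential is written as a product and a sum over singletons to
      match \<open>mean_mixture_le\<close>.\<close>
    have "prob_of (\<lambda>x. bad x j) \<le> mean (\<lambda>x. exp (\<mu> j / 4) * (\<Prod>j\<in>{j}. \<Sum>i\<in>{0::nat}. 1 * exp (- 1 * N x j)))"
      unfolding prob_of_def using of_bool_bad_le by (intro mean_mono) auto
    also have "\<dots> = exp (\<mu> j / 4) * mean (\<lambda>x. \<Prod>j\<in>{j}. \<Sum>i\<in>{0::nat}. 1 * exp (- 1 * N x j))"
      by (rule mean_cmult)
    also have "\<dots> \<le> exp (\<mu> j / 4) * (\<Prod>j\<in>{j}. \<Sum>i\<in>{0::nat}. 1 * exp (\<mu> j * (exp (- 1) - 1)))"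
      using j by (intro mult_left_mono mean_mixture_le) auto
    also have "\<dots> \<le> exp (- 3/8 * \<mu> j)" using exp_exponent_bad[of j] j by simp
    also have "\<dots> \<le> exp (- L - ln (real d))"
    proof -
      have "0 \<le> ln (real d)" "3 * (L + ln (real d)) < \<mu> j" using d j by simp_all
      then have "- 3/8 * \<mu> j \<le> - L - ln (real d)" using L by argo
      then show ?thesis by simp
    qed
    also have "\<dots> = exp (- L) / real d" using d by (simp add: exp_diff)
    finally show "prob_of (\<lambda>x. bad x j) \<le> exp (- L) / real d" .
  qed
  also have "\<dots> \<le> (\<Sum>j=1..d. exp (- L) / real d)" by (intro sum_mono2) auto
  also have "\<dots> = exp (- L)" using d by simp
  finally show ?thesis .
qed

end

section \<open>Transfer to the probability space and the deterministic bound on the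
  divergence\<close>

context discrete_sample
begin

text \<open>The event splits into the disjoint atoms \<open>E x\<close> on which the sample equals
  \<open>x\<close>, and independence gives each atom the probability
  \<open>weight x\<close>.\<close>

lemma measure_eq_prob_of:
  assumes M: "prob_space M" and iid: "iid_sample M d n P X"
  shows "measure M {\<omega> \<in> space M. A (restrict (\<lambda>i. X i \<omega>) {1..n})} = prob_of A"
proof -
  interpret prob_space M by fact
  have indep: "indep_vars (\<lambda>_. count_space {1..d}) X {1..n}"
    and dist: "\<And>i. i \<in> {1..n} \<Longrightarrow> distributed M (count_space {1..d}) (X i) (\<lambda>j. ennreal (P j))"
    using iid by (auto simp: iid_sample_def)
  have X[measurable]: "X i \<in> measurable M (count_space {1..d})" if "i \<in> {1..n}" for i
    using dist[OF that] by (simp add: distributed_def)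
  define E where "E x = (\<Inter>i\<in>{1..n}. X i -` {x i} \<inter> space M)" for x :: "nat \<Rightarrow> nat"
  have E_sets: "E x \<in> sets M" if "x \<in> samples" for x
    unfolding E_def using samples_in[OF that] n_pos
    by (intro sets.finite_INT measurable_sets[OF X]) auto
  have single: "prob (X i -` {k} \<inter> space M) = P k" if i: "i \<in> {1..n}" and k: "k \<in> {1..d}" for i k
  proof -
    have "emeasure M (X i -` {k} \<inter> space M)
        = (\<integral>\<^sup>+j. ennreal (P j) * indicator {k} j \<partial>count_space {1..d})"
      using k by (intro distributed_emeasure[OF dist[OF i]]) auto
    also have "\<dots> = (\<Sum>j=1..d. ennreal (P j) * indicator {k} j)"
      by (simp add: nn_integral_count_space_finite)
    also have "\<dots> = (\<Sum>j=1..d. if j = k then ennreal (P j) else 0)"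
      by (intro sum.cong) (auto simp: indicator_def)
    also have "\<dots> = ennreal (P k)" using k by simp
    finally show ?thesis using P_nonneg[OF k] by (simp add: measure_def)
  qed
  have prob_E: "prob (E x) = weight x" if x: "x \<in> samples" for x
  proof -
    have "prob (E x) = (\<Prod>i=1..n. prob (X i -` {x i} \<inter> space M))"
      unfolding E_def using samples_in[OF x] n_pos by (intro indep_varsD[OF indep]) auto
    also have "\<dots> = weight x"
      unfolding weight_def using samples_in[OF x] by (intro prod.cong single) auto
    finally show ?thesis .
  qed
  have restrict: "restrict (\<lambda>i. X i \<omega>) {1..n} \<in> samples" if "\<omega> \<in> space M" for \<omega>
    unfolding samples_def using measurable_space[OF X that] by auto
  have in_E: "\<omega> \<in> E x \<longleftrightarrow> \<omega> \<in> space M \<and> x = restrict (\<lambda>i. X i \<omega>) {1..n}" if "x \<in> samples" for \<omega> x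
    using that n_pos unfolding E_def samples_def by (auto simp: PiE_def extensional_def restrict_def fun_eq_iff)
  have "{\<omega> \<in> space M. A (restrict (\<lambda>i. X i \<omega>) {1..n})} = (\<Union>x\<in>{x \<in> samples. A x}. E x)"
    using restrict by (auto simp: in_E)
  also have "prob \<dots> = (\<Sum>x\<in>{x \<in> samples. A x}. prob (E x))"
    using finite_samples E_sets
    by (intro finite_measure_finite_Union) (auto simp: disjoint_family_on_def in_E)
  also have "\<dots> = (\<Sum>x\<in>{x \<in> samples. A x}. weight x)" by (intro sum.cong prob_E) auto
  also have "\<dots> = prob_of A"
    unfolding prob_of_def mean_def using finite_samples by (simp add: sum.inter_filter[symmetric] of_bool_def if_distrib cong: if_cong)
  finally show ?thesis .
qed

lemma d_pos: "d \<ge> 1"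
  using sum_P by (cases d) auto

lemma sum_N: "x \<in> samples \<Longrightarrow> (\<Sum>j=1..d. N x j) = real n"
  using sum_class_count[of x "\<lambda>_. 1"] by simp

text \<open>On a \<open>bad\<close> class the smoothing keeps q \<ge> \<Lambda> / (2 n d), which
  bounds the logarithm. On any other class ln y \<le> y - 1 reduces the term to (p - q)^2 /
  q.\<close>

lemma relative_entropy_term_le:
  assumes x: "x \<in> samples" and j: "j \<in> {1..d}" and \<Lambda>: "0 < \<Lambda>" "\<Lambda> \<le> real n"
    and q: "q = add_estimator d n (\<Lambda> / real d) x j"
  shows "q > 0"
    "P j * ln (P j / q) - P j + q
      \<le> (2 * chi2 (\<mu> j) (N x j) + 2 * (\<Lambda> / real d) + 8 * P j * \<Lambda>) / real n
        + P j * max 0 (ln (2 * \<mu> j * real d / \<Lambda>)) * of_bool (bad x j)" (is "?g \<le> ?r")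
proof -
  define c where "c = \<Lambda> / real d"
  define p where "p = P j"
  define k where "k = N x j"
  define S where "S = real n + \<Lambda>"
  have pos: "c > 0" "real n > 0" "S > 0" "p \<ge> 0" "k \<ge> 0" "real d > 0" "S \<le> 2 * real n" "real n \<le> S"
    using d_pos \<Lambda> n_pos P_nonneg[OF j] by (auto simp: c_def S_def p_def k_def)
  have q': "q = (k + c) / S" using pos(6) by (simp add: q add_estimator_def k_def c_def S_def)
  show q0: "q > 0" using pos by (simp add: q')
  show "?g \<le> ?r"
  proof (cases "bad x j")
    case True
    then have k: "k \<le> real n * p / 4" "\<not> k > real n * p / 4" by (auto simp: bad_def p_def k_def)
    have "q \<le> (k + c) / real n" unfolding q' using pos by (intro divide_left_mono) auto
    also have "\<dots> \<le> (real n * p / 4 + c) / real n" using pos k by (intro divide_right_mono) auto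
    also have "\<dots> = p / 4 + c / real n" using pos by (simp add: field_simps)
    finally have 1: "- p + q \<le> c / real n" using pos by simp
    have "p * ln (p / q) \<le> p * max 0 (ln (2 * (real n * p) * real d / \<Lambda>))"
    proof (cases "p = 0")
      case False
      then have p: "p > 0" using pos by simp
      have "c / (2 * real n) \<le> q" unfolding q' using pos by (intro frac_le) auto
      then have "p / q \<le> p / (c / (2 * real n))" using pos q0 by (intro divide_left_mono) auto
      also have "\<dots> = 2 * (real n * p) * real d / \<Lambda>" by (simp add: c_def)
      finally have "ln (p / q) \<le> ln (2 * (real n * p) * real d / \<Lambda>)" using p q0 by (intro ln_mono) auto
      then show ?thesis using p by (intro mult_left_mono) auto
    qed auto
    moreover have "c / real n \<le> (2 * c + 8 * p * \<Lambda>) / real n"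
      using pos \<Lambda> by (intro divide_right_mono) auto
    ultimately have "p * ln (p / q) - p + q \<le> (2 * c + 8 * p * \<Lambda>) / real n
        + p * max 0 (ln (2 * (real n * p) * real d / \<Lambda>))" using 1 by linarith
    then show ?thesis using True k unfolding chi2_def p_def[symmetric] k_def[symmetric] c_def[symmetric] by simp
  next
    case False
    then have k: "k > real n * p / 4" by (auto simp: bad_def p_def k_def)
    have k0: "k > 0" using k pos by (meson divide_nonneg_pos le_less_trans mult_nonneg_nonneg of_nat_0_le_iff zero_less_numeral)
    \<comment> \<open>Up to the factor 1 / S, the error p - q is the sampling noise \<open>a\<close>
      plus the smoothing bias \<open>b\<close>.\<close>
    define a b where "a = real n * p - k" and "b = p * \<Lambda> - c"
    have "p * ln (p / q) \<le> p * (p / q - 1)"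
    proof (cases "p = 0")
      case False then show ?thesis using pos q0 by (intro mult_left_mono ln_le_minus_one) auto
    qed auto
    then have "p * ln (p / q) - p + q \<le> (p - q)\<^sup>2 / q"
      using q0 by (simp add: field_simps power2_eq_square)
    also have "p - q = (a + b) / S" unfolding q' a_def b_def using pos(3) by (simp add: field_simps S_def)
    also have "((a + b) / S)\<^sup>2 / q = (a + b)\<^sup>2 / (k + c) / S"
      unfolding q' using pos by (simp add: power2_eq_square)
    also have "\<dots> \<le> (a + b)\<^sup>2 / (k + c) / real n"
      using pos by (intro divide_left_mono) auto
    also have "\<dots> \<le> (2 * (a\<^sup>2 / k) + 2 * c + 8 * p * \<Lambda>) / real n"
    proof (intro divide_right_mono)
      have "0 \<le> (a - b)\<^sup>2" by simp
      then have "(a + b)\<^sup>2 \<le> 2 * a\<^sup>2 + 2 * b\<^sup>2" by (simp add: power2_eq_square algebra_simps)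
      moreover have "b\<^sup>2 \<le> (p * \<Lambda>)\<^sup>2 + c\<^sup>2"
        using pos \<Lambda> by (simp add: b_def power2_eq_square algebra_simps)
      \<comment> \<open>Both \<Lambda> \<le> n and the lower bound on the count of a class that is
        not \<open>bad\<close> enter here.\<close>
      moreover have "(p * \<Lambda>)\<^sup>2 \<le> 4 * p * \<Lambda> * (k + c)"
      proof -
        have "p * \<Lambda> \<le> p * real n" using pos \<Lambda> by (intro mult_left_mono) auto
        also have "\<dots> \<le> 4 * (k + c)" using k pos by (simp add: mult.commute)
        finally have "p * \<Lambda> * (p * \<Lambda>) \<le> p * \<Lambda> * (4 * (k + c))"
          using pos \<Lambda> by (intro mult_left_mono) auto
        then show ?thesis by (simp add: power2_eq_square algebra_simps)
      qed
      moreover have "c\<^sup>2 \<le> c * (k + c)" using pos by (simp add: power2_eq_square algebra_simps)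
      moreover have "a\<^sup>2 \<le> a\<^sup>2 / k * (k + c)"
        using k0 pos by (simp add: field_simps)
      ultimately have "(a + b)\<^sup>2 \<le> 2 * (a\<^sup>2 / k * (k + c)) + 2 * (c * (k + c)) + 2 * (4 * p * \<Lambda> * (k + c))"
        by linarith
      also have "\<dots> = (2 * (a\<^sup>2 / k) + 2 * c + 8 * p * \<Lambda>) * (k + c)" by (simp only: algebra_simps)
      finally have "(a + b)\<^sup>2 \<le> (2 * (a\<^sup>2 / k) + 2 * c + 8 * p * \<Lambda>) * (k + c)" .
      then show "(a + b)\<^sup>2 / (k + c) \<le> 2 * (a\<^sup>2 / k) + 2 * c + 8 * p * \<Lambda>"
        using pos by (simp add: divide_le_eq)
    qed (use pos in auto)
    also have "a\<^sup>2 / k = chi2 (\<mu> j) (N x j)"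
      using k unfolding chi2_def p_def[symmetric] k_def[symmetric] a_def by (simp add: power2_commute)
    finally show ?thesis using False by (simp add: p_def c_def)
  qed
qed

text \<open>The added terms - P_j + q_j cancel in total. The 10 is 2 from \<Lambda> / d summed over
  d classes plus 8 from the weights P_j.\<close>

lemma KL_add_estimator_le:
  assumes x: "x \<in> samples" and \<Lambda>: "0 < \<Lambda>" "\<Lambda> \<le> real n"
  shows "KL d P (add_estimator d n (\<Lambda> / real d) x)
    \<le> ereal ((2 * (\<Sum>j=1..d. chi2 (\<mu> j) (N x j)) + 10 * \<Lambda>) / real n
        + (\<Sum>j=1..d. P j * max 0 (ln (2 * \<mu> j * real d / \<Lambda>)) * of_bool (bad x j)))"
proof -
  define q where "q = add_estimator d n (\<Lambda> / real d) x"
  define w where "w = (\<lambda>j. P j * max 0 (ln (2 * \<mu> j * real d / \<Lambda>)) * of_bool (bad x j))"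
  have "(\<Sum>j=1..d. q j) = ((\<Sum>j=1..d. N x j) + \<Lambda>) / (real n + \<Lambda>)"
    using d_pos by (simp add: q_def add_estimator_def sum_divide_distrib[symmetric] sum.distrib)
  then have sum_q: "(\<Sum>j=1..d. q j) = 1" using \<Lambda> unfolding sum_N[OF x] by simp
  have q: "q j > 0" "P j * ln (P j / q j) - P j + q j
      \<le> (2 * chi2 (\<mu> j) (N x j) + 2 * (\<Lambda> / real d) + 8 * P j * \<Lambda>) / real n + w j"
    if "j \<in> {1..d}" for j
    using relative_entropy_term_le[OF x that \<Lambda> refl] unfolding q_def w_def by auto
  have "KL d P q = (\<Sum>j=1..d. ereal (P j * ln (P j / q j)))"
    unfolding KL_def using q(1) by (intro sum.cong) force+
  also have "\<dots> = ereal (\<Sum>j=1..d. P j * ln (P j / q j))" by simp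
  also have "(\<Sum>j=1..d. P j * ln (P j / q j)) = (\<Sum>j=1..d. P j * ln (P j / q j) - P j + q j)"
    unfolding sum.distrib sum_subtractf sum_q sum_P by simp
  also have "ereal \<dots> \<le> ereal (\<Sum>j=1..d. (2 * chi2 (\<mu> j) (N x j) + 2 * (\<Lambda> / real d) + 8 * P j * \<Lambda>) / real n + w j)"
    using q(2) by (intro ereal_less_eq(3)[THEN iffD2] sum_mono)
  also have "(\<Sum>j=1..d. (2 * chi2 (\<mu> j) (N x j) + 2 * (\<Lambda> / real d) + 8 * P j * \<Lambda>) / real n + w j)
      = (2 * (\<Sum>j=1..d. chi2 (\<mu> j) (N x j)) + real d * (2 * (\<Lambda> / real d)) + 8 * (\<Sum>j=1..d. P j) * \<Lambda>) / real n
        + (\<Sum>j=1..d. w j)"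
    by (simp add: sum.distrib sum_divide_distrib[symmetric] sum_distrib_left sum_distrib_right)
  also have "\<dots> = (2 * (\<Sum>j=1..d. chi2 (\<mu> j) (N x j)) + 10 * \<Lambda>) / real n + (\<Sum>j=1..d. w j)"
    unfolding sum_P using d_pos by simp
  finally show ?thesis unfolding q_def w_def .
qed

end

section \<open>Comparison of the exponential weights with the two support sizes\<close>

lemma mult_exp_minus_le_missing:
  fixes y :: real
  assumes "y \<ge> 0"
  shows "y * exp (- 3/16 * y) \<le> 112 * min (exp (1 - y / 112)) (y / 112)"
proof -
  \<comment> \<open>The decay rate 3/16 exceeds 1/112, so 1 + x \<le> e^x absorbs the linear factor
    y into the difference of the rates.\<close>
  have "y \<le> 112 * exp (1 - y / 112 + 3/16 * y)"
    using exp_ge_add_one_self[of "1 - y / 112 + 3/16 * y"] assms by linarith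
  then have "y * exp (- 3/16 * y) \<le> 112 * exp (1 - y / 112 + 3/16 * y) * exp (- 3/16 * y)"
    by (intro mult_right_mono) auto
  also have "\<dots> = 112 * exp (1 - y / 112)" by (simp add: exp_add[symmetric] mult.assoc)
  finally have "y * exp (- 3/16 * y) \<le> 112 * exp (1 - y / 112)" .
  moreover have "y * exp (- 3/16 * y) \<le> y * 1" using assms by (intro mult_left_mono) auto
  ultimately show ?thesis by (auto simp: min_def)
qed

text \<open>The linear and the quadratic Taylor term of e^(3/16 y) give the constants, as 16/3 \<le>
  6 and 512/3 \<le> 171.\<close>

lemma mult_exp_minus_le_min:
  fixes y :: real
  assumes "y \<ge> 0"
  shows "y * exp (- 3/16 * y) \<le> 6 * min y 1" "y * (2 + y) * exp (- 3/16 * y) \<le> 171 * min y 1"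
proof -
  define e where "e = exp (- 3/16 * y)"
  have e: "e * exp (3/16 * y) = 1" "0 < e" "e \<le> 1" using assms by (auto simp: e_def exp_add[symmetric])
  have lower: "1 + 3/16 * y + (3/16 * y)\<^sup>2 / 2 \<le> exp (3/16 * y)"
    using assms by (intro exp_lower_Taylor_quadratic) auto
  have le1: "e * t \<le> C" if "t \<le> C * exp (3/16 * y)" for t C
  proof -
    have "e * t \<le> e * (C * exp (3/16 * y))" using e that by (intro mult_left_mono) auto
    also have "\<dots> = C * (e * exp (3/16 * y))" by (rule mult.left_commute)
    finally show ?thesis unfolding e(1) by simp
  qed
  have "0 \<le> (3/16 * y)\<^sup>2" by simp
  then have "y \<le> 6 * exp (3/16 * y)" using lower assms by linarith
  then have 1: "e * y \<le> 6" by (rule le1)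
  have 2: "e * y \<le> 1 * y" using assms e by (intro mult_right_mono) auto
  show "y * exp (- 3/16 * y) \<le> 6 * min y 1"
    using 1 2 assms unfolding e_def[symmetric] by (auto simp: min_def mult.commute)
  show "y * (2 + y) * exp (- 3/16 * y) \<le> 171 * min y 1"
  proof (cases "y \<le> 1")
    case True
    have "y * (2 + y) * e \<le> y * 3 * 1" using True assms e by (intro mult_mono) auto
    also have "\<dots> \<le> 171 * y" using assms by simp
    finally show ?thesis using True by (simp add: e_def)
  next
    case False
    then have "y * (2 + y) \<le> y * (3 * y)" by (intro mult_left_mono) auto
    also have "\<dots> = 512/3 * ((3/16 * y)\<^sup>2 / 2)" by (simp add: power2_eq_square)
    also have "\<dots> \<le> 171 * ((3/16 * y)\<^sup>2 / 2)" by (intro mult_right_mono) auto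
    also have "\<dots> \<le> 171 * exp (3/16 * y)" using lower False by (intro mult_left_mono) auto
    finally have "e * (y * (2 + y)) \<le> 171" by (rule le1)
    then show ?thesis using False by (simp add: e_def mult.commute)
  qed
qed

section \<open>Effective support sizes and the common high-probability bound\<close>

context discrete_sample
begin

lemma eff_support_size_pos: "s > 0"
proof -
  obtain j where j: "j \<in> {1..d}" "P j > 0"
  proof (rule ccontr)
    assume "\<not> thesis"
    then have "\<And>j. j \<in> {1..d} \<Longrightarrow> P j = 0" using P_nonneg that by fastforce
    then have "(\<Sum>j=1..d. P j) = 0" by (intro sum.neutral) auto
    then show False using sum_P by linarith
  qed
  then have "0 < min (\<mu> j) 1" using n_pos by simp
  also have "\<dots> \<le> s" unfolding eff_support_size_def
    using j(1) P_nonneg by (intro member_le_sum) auto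
  finally show ?thesis .
qed

lemma eff_support_size_le: "s \<le> real d"
  unfolding eff_support_size_def using sum_bounded_above[of "{1..d}" "\<lambda>j. min (\<mu> j) 1" 1] by simp

lemma eff_support_size_split:
  "s = real (card {j \<in> {1..d}. \<mu> j \<ge> 1}) + (\<Sum>j\<in>{j \<in> {1..d}. \<mu> j < 1}. \<mu> j)"
proof -
  have "s = (\<Sum>j\<in>{j \<in> {1..d}. \<mu> j \<ge> 1} \<union> {j \<in> {1..d}. \<mu> j < 1}. min (\<mu> j) 1)"
    unfolding eff_support_size_def by (intro sum.cong) auto
  also have "\<dots> = (\<Sum>j\<in>{j \<in> {1..d}. \<mu> j \<ge> 1}. min (\<mu> j) 1) + (\<Sum>j\<in>{j \<in> {1..d}. \<mu> j < 1}. min (\<mu> j) 1)"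
    by (intro sum.union_disjoint) auto
  also have "(\<Sum>j\<in>{j \<in> {1..d}. \<mu> j \<ge> 1}. min (\<mu> j) 1) = (\<Sum>j\<in>{j \<in> {1..d}. \<mu> j \<ge> 1}. 1)"
    by (intro sum.cong) auto
  also have "(\<Sum>j\<in>{j \<in> {1..d}. \<mu> j < 1}. min (\<mu> j) 1) = (\<Sum>j\<in>{j \<in> {1..d}. \<mu> j < 1}. \<mu> j)"
    by (intro sum.cong) auto
  finally show ?thesis by simp
qed

lemma sum_split_support:
  "(\<Sum>j=1..d. f j) = (\<Sum>j\<in>{j \<in> {1..d}. \<mu> j \<ge> 1}. f j) + (\<Sum>j\<in>{j \<in> {1..d}. \<mu> j < 1}. f j :: real)"
proof -
  have "{1..d} = {j \<in> {1..d}. \<mu> j \<ge> 1} \<union> {j \<in> {1..d}. \<mu> j < 1}" by auto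
  then show ?thesis by (metis (no_types, lifting) sum.union_disjoint finite_Un finite_atLeastAtMost disjoint_iff mem_Collect_eq not_le)
qed

text \<open>Integrality of the count is the point: a nonzero value forces N \<ge> 1 > \<mu>, and
  then the deviation is at most N.\<close>

lemma chi2_le_count: "j \<in> {1..d} \<Longrightarrow> \<mu> j < 1 \<Longrightarrow> chi2 (\<mu> j) (N x j) \<le> N x j"
proof -
  assume j: "j \<in> {1..d}" "\<mu> j < 1"
  have m: "\<mu> j \<ge> 0" using \<mu>_nonneg j by simp
  show ?thesis
  proof (cases "N x j > \<mu> j / 4")
    case True
    then have "class_count n x j \<noteq> 0" using m by (intro notI) simp
    then have N1: "N x j \<ge> 1" by simp
    have "(N x j - \<mu> j)\<^sup>2 \<le> (N x j)\<^sup>2" using m j N1 by (intro power_mono) auto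
    then show ?thesis using N1 by (simp add: chi2_def divide_le_eq power2_eq_square)
  qed (auto simp: chi2_def)
qed

lemma distinct_classes_eq: "real (distinct_classes d n x) = (\<Sum>j=1..d. of_bool (class_count n x j \<ge> 1))"
  unfolding distinct_classes_def of_nat_sum of_nat_of_bool ..

text \<open>The split mirrors \<open>eff_support_size_split\<close>, so that
  \<open>count_deviation\<close> on the rare classes yields the upper bound 2 s + L.\<close>

lemma distinct_classes_le_split:
  "real (distinct_classes d n x)
    \<le> real (card {j \<in> {1..d}. \<mu> j \<ge> 1}) + (\<Sum>j\<in>{j \<in> {1..d}. \<mu> j < 1}. N x j)"
proof -
  have "(\<Sum>j\<in>{j \<in> {1..d}. \<mu> j \<ge> 1}. of_bool (class_count n x j \<ge> 1)) \<le> (\<Sum>j\<in>{j \<in> {1..d}. \<mu> j \<ge> 1}. 1 :: real)"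
    by (intro sum_mono) auto
  moreover have "(\<Sum>j\<in>{j \<in> {1..d}. \<mu> j < 1}. of_bool (class_count n x j \<ge> 1)) \<le> (\<Sum>j\<in>{j \<in> {1..d}. \<mu> j < 1}. N x j)"
    by (intro sum_mono) auto
  ultimately show ?thesis unfolding distinct_classes_eq sum_split_support[of "\<lambda>j. of_bool (class_count n x j \<ge> 1)"] by simp
qed

lemma distinct_classes_bounds:
  assumes x: "x \<in> samples"
  shows "1 \<le> real (distinct_classes d n x)" "real (distinct_classes d n x) \<le> real n"
proof -
  have x1: "x 1 \<in> {1..d}" using samples_in[OF x] n_pos by simp
  have "1 \<le> class_count n x (x 1)"
    unfolding class_count_def using n_pos
    by (intro order.trans[OF _ member_le_sum[of 1]]) auto
  then have "1 = (of_bool (class_count n x (x 1) \<ge> 1) :: real)" by simp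
  also have "\<dots> \<le> real (distinct_classes d n x)"
    unfolding distinct_classes_eq using x1 by (intro member_le_sum) auto
  finally show "1 \<le> real (distinct_classes d n x)" .
  have "real (distinct_classes d n x) \<le> (\<Sum>j=1..d. N x j)"
    unfolding distinct_classes_eq by (intro sum_mono) auto
  then show "real (distinct_classes d n x) \<le> real n" using sum_N[OF x] by simp
qed

abbreviation s' :: real where "s' \<equiv> eff_missing_support_size d (real n / 112) P"

lemma eff_missing_support_size_nonneg: "s' \<ge> 0"
  unfolding eff_missing_support_size_def using P_nonneg by (intro sum_nonneg) auto

lemma missing_log_ge_1: "ln (exp 1 * real d / s) \<ge> 1"
proof -
  have "exp 1 \<le> exp 1 * real d / s"
    using eff_support_size_pos eff_support_size_le by (simp add: le_divide_eq)
  then show ?thesis using eff_support_size_pos d_pos by (simp add: ln_ge_iff)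
qed

text \<open>
  If \<open>s \<ge> 8 * L\<close>, the logarithm is at most \<open>ln (e d / s)\<close> up to terms absorbed by the exponential;
  otherwise \<open>s\<close> itself is of order \<open>L\<close> and the crude bound \<open>5 * V\<close> on the logarithm suffices.
\<close>

lemma expected_bad_le:
  assumes L: "L > 0" and V: "V \<ge> 0" and \<Lambda>0: "\<Lambda>0 > 0" "8 * L \<le> s \<Longrightarrow> s / 10 \<le> \<Lambda>0"
    and A: "A \<subseteq> {1..d}" "\<And>j. j \<in> A \<Longrightarrow> max 0 (ln (2 * \<mu> j * real d / \<Lambda>0)) \<le> 5 * V"
  shows "(\<Sum>j\<in>A. \<mu> j * exp (- 3/16 * \<mu> j) * max 0 (ln (2 * \<mu> j * real d / \<Lambda>0)))
    \<le> 112 * (s' * ln (exp 1 * real d / s)) + 171 * s + 240 * (V * L)"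
proof (cases "8 * L \<le> s")
  case True
  define l where "l = ln (exp 1 * real d / s)"
  have l: "l \<ge> 1" using missing_log_ge_1 by (simp add: l_def)
  have "(\<Sum>j\<in>A. \<mu> j * exp (- 3/16 * \<mu> j) * max 0 (ln (2 * \<mu> j * real d / \<Lambda>0)))
     \<le> (\<Sum>j\<in>A. l * (112 * min (exp (1 - real n / 112 * P j)) (real n / 112 * P j)) + 171 * min (\<mu> j) 1)"
  proof (intro sum_mono)
    fix j assume j: "j \<in> A"
    have m: "\<mu> j \<ge> 0" using \<mu>_nonneg j A by auto
    show "\<mu> j * exp (- 3/16 * \<mu> j) * max 0 (ln (2 * \<mu> j * real d / \<Lambda>0))
      \<le> l * (112 * min (exp (1 - real n / 112 * P j)) (real n / 112 * P j)) + 171 * min (\<mu> j) 1"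
    proof (cases "\<mu> j = 0")
      case False
      then have mp: "\<mu> j > 0" using m by linarith
      have "2 * \<mu> j * real d / \<Lambda>0 \<le> 2 * \<mu> j * real d / (s / 10)"
        using True \<Lambda>0 mp eff_support_size_pos by (intro divide_left_mono) auto
      also have "\<dots> \<le> (exp 1 * real d / s) * (exp 3 * \<mu> j)"
      proof -
        \<comment> \<open>Replacing \<open>\<Lambda>0\<close> by s / 10 costs the factor 2 * 10,
          absorbed by e * e^3. The first e completes e d / s, and the 3 joins ln \<mu> \<le> \<mu> -
          1 to give 2 + \<mu>.\<close>
        have "(20 :: real) \<le> (8/3) ^ 4" by (simp add: power_divide)
        also have "\<dots> \<le> exp 1 ^ 4"
          using exp_minus_1_le by (intro power_mono) (auto simp: exp_minus field_simps)
        also have "\<dots> = exp 1 * exp 3" by (simp add: exp_of_nat_mult[symmetric] exp_add[symmetric])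
        finally have "20 * (\<mu> j * real d / s) \<le> exp 1 * exp 3 * (\<mu> j * real d / s)"
          using mp eff_support_size_pos by (intro mult_right_mono) auto
        then show ?thesis by (simp add: algebra_simps)
      qed
      finally have "ln (2 * \<mu> j * real d / \<Lambda>0) \<le> ln ((exp 1 * real d / s) * (exp 3 * \<mu> j))"
        using mp d_pos \<Lambda>0 by (intro ln_mono) auto
      also have "\<dots> = l + (3 + ln (\<mu> j))"
        using mp d_pos eff_support_size_pos unfolding l_def by (subst ln_mult_pos) (auto simp: ln_mult_pos)
      also have "\<dots> \<le> l + (2 + \<mu> j)" using ln_le_minus_one[OF mp] by simp
      finally have ub: "max 0 (ln (2 * \<mu> j * real d / \<Lambda>0)) \<le> l + (2 + \<mu> j)" using l mp by simp
      have "\<mu> j * exp (- 3/16 * \<mu> j) * max 0 (ln (2 * \<mu> j * real d / \<Lambda>0))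
        \<le> \<mu> j * exp (- 3/16 * \<mu> j) * (l + (2 + \<mu> j))"
        using m ub by (intro mult_left_mono) auto
      also have "\<dots> = l * (\<mu> j * exp (- 3/16 * \<mu> j)) + \<mu> j * (2 + \<mu> j) * exp (- 3/16 * \<mu> j)"
        by (simp add: algebra_simps)
      also have "\<dots> \<le> l * (112 * min (exp (1 - \<mu> j / 112)) (\<mu> j / 112)) + 171 * min (\<mu> j) 1"
        using l by (intro add_mono mult_left_mono mult_exp_minus_le_missing mult_exp_minus_le_min m) auto
      finally show ?thesis by simp
    qed (use l m in auto)
  qed
  also have "\<dots> \<le> (\<Sum>j=1..d. l * (112 * min (exp (1 - real n / 112 * P j)) (real n / 112 * P j)) + 171 * min (\<mu> j) 1)"
    using A l P_nonneg by (intro sum_mono2) (auto intro!: add_nonneg_nonneg mult_nonneg_nonneg)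
  also have "\<dots> = 112 * (s' * l) + 171 * s"
    unfolding eff_missing_support_size_def eff_support_size_def
    by (simp add: sum.distrib sum_distrib_left sum_distrib_right mult_ac)
  also have "\<dots> \<le> 112 * (s' * l) + 171 * s + 240 * (V * L)" using L V by simp
  finally show ?thesis unfolding l_def .
next
  case False
  have "(\<Sum>j\<in>A. \<mu> j * exp (- 3/16 * \<mu> j) * max 0 (ln (2 * \<mu> j * real d / \<Lambda>0)))
     \<le> (\<Sum>j\<in>A. 6 * min (\<mu> j) 1 * (5 * V))"
  proof (intro sum_mono)
    fix j assume j: "j \<in> A"
    have m: "\<mu> j \<ge> 0" using \<mu>_nonneg j A by auto
    show "\<mu> j * exp (- 3/16 * \<mu> j) * max 0 (ln (2 * \<mu> j * real d / \<Lambda>0)) \<le> 6 * min (\<mu> j) 1 * (5 * V)"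
      using m j A by (intro mult_mono mult_exp_minus_le_min) auto
  qed
  also have "\<dots> \<le> (\<Sum>j=1..d. 6 * min (\<mu> j) 1 * (5 * V))"
    using A V P_nonneg by (intro sum_mono2) (auto intro!: mult_nonneg_nonneg)
  also have "\<dots> = 30 * V * s"
    unfolding eff_support_size_def by (simp add: sum_distrib_left mult_ac)
  \<comment> \<open>Here s < 8 L, so the whole sum is charged to V L.\<close>
  also have "\<dots> \<le> 30 * V * (8 * L)" using False V by (intro mult_left_mono) auto
  also have "\<dots> = 240 * (V * L)" by simp
  also have "\<dots> \<le> 112 * (s' * ln (exp 1 * real d / s)) + 171 * s + 240 * (V * L)"
    using eff_missing_support_size_nonneg eff_support_size_pos missing_log_ge_1 by simp
  finally show ?thesis .
qed

text \<open>Both estimators are covered: \<Lambda> is the total pseudo-count, \<open>D\<close> for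
  the first and max D L for the second. The number \<open>\<Lambda>0\<close> is a deterministic
  lower bound for it on the good event, which makes the logarithms nonrandom weights.\<close>

lemma prob_KL_add_estimator:
  assumes L: "L > 0" and V: "V \<ge> 1"
    and \<Lambda>: "\<And>x. x \<in> samples \<Longrightarrow> real (distinct_classes d n x) \<le> \<Lambda> x"
      "\<And>x. x \<in> samples \<Longrightarrow> \<Lambda> x \<le> max (real (distinct_classes d n x)) L" and Ln: "L \<le> real n"
    and \<Lambda>0: "\<Lambda>0 > 0" "8 * L \<le> s \<Longrightarrow> \<Lambda>0 = s / 10"
      "\<And>x. x \<in> samples \<Longrightarrow> \<not> 8 * L \<le> s \<Longrightarrow> \<Lambda>0 \<le> \<Lambda> x"
    and log_le: "ln (6 * (L + ln (real d)) * real d / \<Lambda>0) \<le> 5 * V"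
  shows "prob_of (\<lambda>x. KL d P (add_estimator d n (\<Lambda> x / real d) x)
      \<le> ereal (121000 * ((s + s' * ln (exp 1 * real d / s) + V * L) / real n))) \<ge> 1 - 14 * exp (- L)"
proof -
  define H where "H = {j \<in> {1..d}. \<mu> j \<ge> 1}"
  define J where "J = {j \<in> {1..d}. \<mu> j < 1}"
  \<comment> \<open>\<open>E4\<close> rules out \<open>bad\<close> classes in \<open>B\<close>,
    while on its complement \<open>A\<close> the logarithms are at most 5 V.\<close>
  define B where "B = {j \<in> {1..d}. \<mu> j > 3 * (L + ln (real d))}"
  define A where "A = {1..d} - B"
  define lg where "lg = (\<lambda>j. max 0 (ln (2 * \<mu> j * real d / \<Lambda>0)))"
  define a where "a = (\<lambda>j. P j * lg j)"
  \<comment> \<open>Chosen so that t P_j (5 V) = 3/16 \<mu>_j, the limit in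
    \<open>weighted_bad_deviation\<close>.\<close>
  define t where "t = 3 * real n / (80 * V)"
  define b where "b = (\<Sum>j\<in>A. a j * exp (- 3/16 * \<mu> j))"
  define E1 where "E1 = (\<lambda>x. (\<Sum>j\<in>H. chi2 (\<mu> j) (N x j)) / 32 > 3 * real (card H) + L)"
  define E2 where "E2 = (\<lambda>x. (\<Sum>j\<in>J. N x j) > 2 * (\<Sum>j\<in>J. \<mu> j) + L)"
  define E3 where "E3 = (\<lambda>x. - real (distinct_classes d n x) > - (25/104) * s + L)"
  define E4 where "E4 = (\<lambda>x. \<exists>j\<in>B. bad x j)"
  define E5 where "E5 = (\<lambda>x. (\<Sum>j\<in>A. a j * of_bool (bad x j)) > b + L / t)"
  have t: "t > 0" using V n_pos by (simp add: t_def)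
  have A: "A \<subseteq> {1..d}" by (auto simp: A_def)
  have lg: "0 \<le> lg j" for j by (simp add: lg_def)
  have lgA: "lg j \<le> 5 * V" if j: "j \<in> A" for j
  proof (cases "\<mu> j = 0")
    case False
    then have m: "\<mu> j > 0" using \<mu>_nonneg[of j] j A by (intro order.not_eq_order_implies_strict) auto
    have "\<mu> j \<le> 3 * (L + ln (real d))" using j by (auto simp: A_def B_def)
    then have "2 * \<mu> j * real d / \<Lambda>0 \<le> 2 * (3 * (L + ln (real d))) * real d / \<Lambda>0"
      using \<Lambda>0(1) by (intro divide_right_mono mult_right_mono) auto
    then have "ln (2 * \<mu> j * real d / \<Lambda>0) \<le> ln (6 * (L + ln (real d)) * real d / \<Lambda>0)"
      using m \<Lambda>0(1) d_pos by (intro ln_mono) auto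
    then show ?thesis using log_le V by (simp add: lg_def)
  next
    case True
    show ?thesis unfolding lg_def True using V by simp
  qed
  have "prob_of E1 \<le> exp (- L)" unfolding E1_def by (intro chi2_deviation) (auto simp: H_def)
  moreover have "prob_of E2 \<le> exp (- L)" unfolding E2_def by (intro count_deviation) (auto simp: J_def)
  moreover have "prob_of E3 \<le> exp (- L)" unfolding E3_def by (rule distinct_classes_lower)
  moreover have "prob_of E4 \<le> exp (- L)" unfolding E4_def B_def using L d_pos by (intro bad_large) auto
  moreover have "prob_of E5 \<le> exp (- L)" unfolding E5_def b_def
  proof (intro weighted_bad_deviation A t)
    fix j assume j: "j \<in> A"
    then have p: "0 \<le> P j" using A P_nonneg by auto
    then show "0 \<le> a j" using lg by (simp add: a_def)
    have "t * a j \<le> t * (P j * (5 * V))" unfolding a_def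
      using p lgA[OF j] t by (intro mult_left_mono) auto
    also have "\<dots> = 3/16 * \<mu> j" using V by (simp add: t_def)
    finally show "t * a j \<le> 3/16 * \<mu> j" .
  qed
  moreover have "prob_of (\<lambda>x. E1 x \<or> E2 x \<or> E3 x \<or> E4 x \<or> E5 x) \<le> prob_of E1 + (prob_of E2 + (prob_of E3 + (prob_of E4 + prob_of E5)))"
    by (intro order.trans[OF prob_of_disj] add_left_mono order.refl)
  ultimately have fail: "prob_of (\<lambda>x. E1 x \<or> E2 x \<or> E3 x \<or> E4 x \<or> E5 x) \<le> 5 * exp (- L)" by linarith
  have "1 - 14 * exp (- L) \<le> 1 - 5 * exp (- L)" by simp
  also have "\<dots> \<le> prob_of (\<lambda>x. \<not> (E1 x \<or> E2 x \<or> E3 x \<or> E4 x \<or> E5 x))"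
    using fail unfolding prob_of_not[of "\<lambda>x. \<not> (E1 x \<or> E2 x \<or> E3 x \<or> E4 x \<or> E5 x)"] by simp
  also have "\<dots> \<le> prob_of (\<lambda>x. KL d P (add_estimator d n (\<Lambda> x / real d) x)
      \<le> ereal (121000 * ((s + s' * ln (exp 1 * real d / s) + V * L) / real n)))"
  proof (intro prob_of_mono)
    fix x assume x: "x \<in> samples" and good: "\<not> (E1 x \<or> E2 x \<or> E3 x \<or> E4 x \<or> E5 x)"
    define D where "D = real (distinct_classes d n x)"
    have D: "1 \<le> D" "D \<le> real n" using distinct_classes_bounds[OF x] by (auto simp: D_def)
    have s_eq: "s = real (card H) + (\<Sum>j\<in>J. \<mu> j)" using eff_support_size_split by (simp add: H_def J_def)
    have muJ: "0 \<le> (\<Sum>j\<in>J. \<mu> j)" using P_nonneg by (intro sum_nonneg) (auto simp: J_def)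
    have NJ: "(\<Sum>j\<in>J. N x j) \<le> 2 * (\<Sum>j\<in>J. \<mu> j) + L" using good by (auto simp: E2_def)
    have Lx: "D \<le> \<Lambda> x" "\<Lambda> x \<le> max D L" "\<Lambda> x > 0" "\<Lambda> x \<le> real n"
      using \<Lambda>[OF x] D Ln by (auto simp: D_def)
    have "D \<le> 2 * s + L"
      using distinct_classes_le_split[of x] NJ muJ unfolding s_eq D_def H_def[symmetric] J_def[symmetric] by simp
    then have \<Lambda>_up: "\<Lambda> x \<le> 2 * s + L" using Lx eff_support_size_pos L by simp
    have \<Lambda>_low: "\<Lambda>0 \<le> \<Lambda> x"
    proof (cases "8 * L \<le> s")
      case True
      \<comment> \<open>With L \<le> s / 8 this leaves at least (25/104 - 1/8) s = 3/26 s, which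
        exceeds s / 10.\<close>
      have "D \<ge> 25/104 * s - L" using good by (simp add: E3_def D_def)
      then have "s / 10 \<le> D" using True eff_support_size_pos by simp
      then show ?thesis using \<Lambda>0(2)[OF True] Lx by simp
    qed (use \<Lambda>0(3)[OF x] in simp)
    have "(\<Sum>j\<in>J. chi2 (\<mu> j) (N x j)) \<le> (\<Sum>j\<in>J. N x j)"
      by (intro sum_mono chi2_le_count) (auto simp: J_def)
    moreover have "(\<Sum>j\<in>H. chi2 (\<mu> j) (N x j)) \<le> 96 * real (card H) + 32 * L" using good by (simp add: E1_def)
    ultimately have chi: "(\<Sum>j=1..d. chi2 (\<mu> j) (N x j)) \<le> 96 * s + 33 * L"
      using NJ muJ unfolding sum_split_support[of "\<lambda>j. chi2 (\<mu> j) (N x j)"] s_eq H_def[symmetric] J_def[symmetric] by simp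
    have "(\<Sum>j=1..d. P j * max 0 (ln (2 * \<mu> j * real d / \<Lambda> x)) * of_bool (bad x j))
        \<le> (\<Sum>j=1..d. a j * of_bool (bad x j))"
    proof (intro sum_mono mult_right_mono)
      fix j assume j: "j \<in> {1..d}"
      show "P j * max 0 (ln (2 * \<mu> j * real d / \<Lambda> x)) \<le> a j"
      proof (cases "P j = 0")
        case False
        then have p: "P j > 0" using P_nonneg[OF j] by simp
        have "2 * \<mu> j * real d / \<Lambda> x \<le> 2 * \<mu> j * real d / \<Lambda>0"
          using \<Lambda>_low \<Lambda>0(1) p by (intro divide_left_mono) auto
        then have "ln (2 * \<mu> j * real d / \<Lambda> x) \<le> ln (2 * \<mu> j * real d / \<Lambda>0)"
          using p Lx(3) d_pos n_pos by (intro ln_mono) auto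
        then show ?thesis unfolding a_def lg_def using p by (intro mult_left_mono) auto
      qed (simp add: a_def)
    qed auto
    also have "\<dots> = (\<Sum>j\<in>A. a j * of_bool (bad x j))"
      using good by (intro sum.mono_neutral_right) (auto simp: A_def E4_def)
    also have "\<dots> \<le> b + L / t" using good by (simp add: E5_def)
    also have "b = (\<Sum>j\<in>A. \<mu> j * exp (- 3/16 * \<mu> j) * lg j) / real n"
      unfolding b_def a_def sum_divide_distrib using n_pos by (intro sum.cong) auto
    also have "L / t = 80/3 * (V * L) / real n" using V n_pos by (simp add: t_def)
    finally have R: "(\<Sum>j=1..d. P j * max 0 (ln (2 * \<mu> j * real d / \<Lambda> x)) * of_bool (bad x j))
        \<le> ((\<Sum>j\<in>A. \<mu> j * exp (- 3/16 * \<mu> j) * lg j) + 80/3 * (V * L)) / real n"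
      by (simp add: add_divide_distrib)
    have eb: "(\<Sum>j\<in>A. \<mu> j * exp (- 3/16 * \<mu> j) * lg j)
        \<le> 112 * (s' * ln (exp 1 * real d / s)) + 171 * s + 240 * (V * L)"
      unfolding lg_def using L V \<Lambda>0 A lgA[unfolded lg_def] by (intro expected_bad_le) auto
    have sl: "0 \<le> s' * ln (exp 1 * real d / s)"
      using eff_missing_support_size_nonneg missing_log_ge_1 by (intro mult_nonneg_nonneg) auto
    have VL: "L \<le> V * L" using V L by simp
    have "(2 * (\<Sum>j=1..d. chi2 (\<mu> j) (N x j)) + 10 * \<Lambda> x) / real n
        + (\<Sum>j=1..d. P j * max 0 (ln (2 * \<mu> j * real d / \<Lambda> x)) * of_bool (bad x j))
      \<le> (2 * (\<Sum>j=1..d. chi2 (\<mu> j) (N x j)) + 10 * \<Lambda> x) / real n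
        + ((\<Sum>j\<in>A. \<mu> j * exp (- 3/16 * \<mu> j) * lg j) + 80/3 * (V * L)) / real n"
      using R by simp
    also have "\<dots> = (2 * (\<Sum>j=1..d. chi2 (\<mu> j) (N x j)) + 10 * \<Lambda> x
        + ((\<Sum>j\<in>A. \<mu> j * exp (- 3/16 * \<mu> j) * lg j) + 80/3 * (V * L))) / real n"
      by (simp add: add_divide_distrib)
    \<comment> \<open>The contributions add up to at most 383 s, 112 times the product of s' and the
      logarithm, and 343 V L.\<close>
    also have "\<dots> \<le> (121000 * (s + s' * ln (exp 1 * real d / s) + V * L)) / real n"
      using chi \<Lambda>_up eb sl VL L eff_support_size_pos by (intro divide_right_mono) (argo, simp)
    also have "\<dots> = 121000 * ((s + s' * ln (exp 1 * real d / s) + V * L) / real n)" by (rule times_divide_eq_right[symmetric])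
    finally show "KL d P (add_estimator d n (\<Lambda> x / real d) x)
      \<le> ereal (121000 * ((s + s' * ln (exp 1 * real d / s) + V * L) / real n))"
      by (intro order.trans[OF KL_add_estimator_le[OF x Lx(3,4)]] ereal_less_eq(3)[THEN iffD2])
  qed
  finally show ?thesis .
qed

end

section \<open>The logarithmic factors of the two estimators and the conclusion\<close>

lemma ln_log_bound_adaptive:
  fixes L \<Lambda>0 :: real and d :: nat
  assumes d: "d \<ge> 3" and L: "L > 0" and \<Lambda>0: "\<Lambda>0 \<ge> 1"
    and V: "V = max (ln (real d)) (ln L)"
  shows "V \<ge> 1" "ln (6 * (L + ln (real d)) * real d / \<Lambda>0) \<le> 5 * V"
proof -
  have "exp 1 \<le> real d" using exp_le d by linarith
  then have "ln (real d) \<ge> 1" using d by (simp add: ln_ge_iff)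
  then show V1: "V \<ge> 1" using V by simp
  have dV: "real d \<le> exp V" "L \<le> exp V" using V d L by (auto simp: ln_le_cancel_iff[symmetric] simp del: ln_le_cancel_iff)
  have ld: "0 \<le> ln (real d)" "ln (real d) \<le> real d" using d ln_le_minus_one[of "real d"] by auto
  have "6 * (L + ln (real d)) * real d / \<Lambda>0 \<le> 6 * (L + ln (real d)) * real d / 1"
    using \<Lambda>0 L ld d by (intro divide_left_mono) auto
  \<comment> \<open>Each of d, ln d and L is at most e^V; the resulting 12 e^(2 V) is at most e^(5
    V) because 12 \<le> e^3 and V \<ge> 1.\<close>
  also have "\<dots> \<le> 6 * (exp V + exp V) * exp V / 1"
    using dV ld L by (intro divide_right_mono mult_mono add_mono) auto
  also have "\<dots> = 12 * (exp V * exp V)" by simp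
  also have "\<dots> \<le> exp (3 * V) * (exp V * exp V)"
  proof (intro mult_right_mono)
    have "(12 :: real) \<le> (8/3) ^ 3" by (simp add: power_divide)
    also have "\<dots> \<le> exp 1 ^ 3"
      using exp_minus_1_le by (intro power_mono) (auto simp: exp_minus field_simps)
    also have "\<dots> \<le> exp (3 * V)" using V1 by (simp add: exp_of_nat_mult[symmetric])
    finally show "12 \<le> exp (3 * V)" .
  qed auto
  also have "\<dots> = exp (5 * V)" by (simp add: exp_add[symmetric])
  finally have le: "6 * (L + ln (real d)) * real d / \<Lambda>0 \<le> exp (5 * V)" .
  have "0 < 6 * (L + ln (real d)) * real d / \<Lambda>0" using L ld d \<Lambda>0 by (intro divide_pos_pos mult_pos_pos add_pos_nonneg) auto
  then have "ln (6 * (L + ln (real d)) * real d / \<Lambda>0) \<le> ln (exp (5 * V))" using le by (intro ln_mono)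
  then show "ln (6 * (L + ln (real d)) * real d / \<Lambda>0) \<le> 5 * V" by simp
qed

text \<open>The pseudo-count is now at least of order L, which cancels the L in the numerator, so ln
  L disappears. What remains is at most 15/2 d^2, and 15/2 \<le> 3^3 \<le> d^3.\<close>

lemma ln_log_bound_conf:
  fixes L \<Lambda>0 :: real and d :: nat
  assumes d: "d \<ge> 3" and L: "L \<ge> 1" and \<Lambda>0: "\<Lambda>0 \<ge> 4/5 * L"
  shows "ln (6 * (L + ln (real d)) * real d / \<Lambda>0) \<le> 5 * ln (real d)"
proof -
  have ld: "0 \<le> ln (real d)" "ln (real d) \<le> real d - 1" using d ln_le_minus_one[of "real d"] by auto
  have "6 * (L + ln (real d)) * real d / \<Lambda>0 \<le> 6 * (L + ln (real d)) * real d / (4/5 * L)"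
    using \<Lambda>0 L ld d by (intro divide_left_mono) auto
  also have "\<dots> \<le> 6 * (L + L * ln (real d)) * real d / (4/5 * L)"
    using L ld mult_right_mono[of 1 L "ln (real d)"] by (intro divide_right_mono mult_right_mono) auto
  also have "\<dots> = 15/2 * (1 + ln (real d)) * real d" using L by (simp add: field_simps)
  also have "\<dots> \<le> 15/2 * real d * real d" using ld by (intro mult_right_mono) auto
  also have "\<dots> \<le> 3 ^ 3 * (real d * real d)" by simp
  also have "\<dots> \<le> real d ^ 3 * (real d * real d)" using d by (intro mult_right_mono power_mono) auto
  also have "\<dots> = real d ^ 5" by (simp add: eval_nat_numeral)
  finally have le: "6 * (L + ln (real d)) * real d / \<Lambda>0 \<le> real d ^ 5" .
  have "0 < 6 * (L + ln (real d)) * real d / \<Lambda>0" using L ld d \<Lambda>0 by (intro divide_pos_pos mult_pos_pos add_pos_nonneg) auto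
  then have "ln (6 * (L + ln (real d)) * real d / \<Lambda>0) \<le> ln (real d ^ 5)" using le by (intro ln_mono)
  then show ?thesis using d by (simp add: ln_realpow)
qed

theorem theorem5:
  fixes n d :: nat and \<delta> :: real and P :: "nat \<Rightarrow> real"
    and M :: "'a measure" and X :: "nat \<Rightarrow> 'a \<Rightarrow> nat"
    and s s' :: real
  assumes "n \<ge> 12" and "d \<ge> 3"
    and "\<delta> \<in> {exp (- real n / 6)<..<exp (- 2)}"
    and "P \<in> prob_vectors d"
    and "prob_space M"
    and "iid_sample M d n P X"
    and "s = eff_support_size d n P"
    and "s' = eff_missing_support_size d (real n / 112) P"
  shows "measure M {\<omega> \<in> space M.
           KL d P (adaptive_estimator d n (\<lambda>i. X i \<omega>))
             \<le> ereal (121000 * ((s + s' * ln (exp 1 * real d / s)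
                   + max (ln (real d)) (ln (ln (1 / \<delta>))) * ln (1 / \<delta>)) / real n))}
           \<ge> 1 - 14 * \<delta>
       \<and> measure M {\<omega> \<in> space M.
           KL d P (adaptive_conf_estimator d n \<delta> (\<lambda>i. X i \<omega>))
             \<le> ereal (121000 * ((s + s' * ln (exp 1 * real d / s)
                   + ln (real d) * ln (1 / \<delta>)) / real n))}
           \<ge> 1 - 14 * \<delta>"
proof -
  interpret discrete_sample n d P using assms(1,4) by unfold_locales auto
  define L where "L = ln (1 / \<delta>)"
  have \<delta>: "\<delta> > 0" using assms(3) by (auto intro: less_trans[OF exp_gt_zero])
  have \<delta>_eq: "\<delta> = exp (- L)" using \<delta> by (simp add: L_def ln_div)
  have L: "2 < L" "L \<le> real n" using assms(3) unfolding \<delta>_eq by auto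
  \<comment> \<open>For large s the lower deviation of the number of classes gives s / 10; otherwise
    the sure bounds D \<ge> 1 and max D L \<ge> L are used. In the first regime s / 10 \<ge> 4/5 L,
    which also exceeds 1 because L > 2.\<close>
  define \<Lambda>1 \<Lambda>2 where "\<Lambda>1 = (if 8 * L \<le> s then s / 10 else 1)" and "\<Lambda>2 = (if 8 * L \<le> s then s / 10 else L)"
  have \<Lambda>12: "\<Lambda>1 \<ge> 1" "\<Lambda>2 \<ge> 4/5 * L" using L by (auto simp: \<Lambda>1_def \<Lambda>2_def)
  have "1 - 14 * \<delta> \<le> prob_of (\<lambda>x. KL d P (adaptive_estimator d n x)
    \<le> ereal (121000 * ((s + s' * ln (exp 1 * real d / s) + max (ln (real d)) (ln L) * L) / real n)))"
    unfolding adaptive_estimator_def \<delta>_eq assms(7,8)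
    using L \<Lambda>12 distinct_classes_bounds ln_log_bound_adaptive[OF assms(2) _ \<Lambda>12(1) refl, of L]
    by (intro prob_KL_add_estimator[where ?\<Lambda>0.0 = \<Lambda>1]) (auto simp: \<Lambda>1_def assms(7,8))
  moreover have "1 - 14 * \<delta> \<le> prob_of (\<lambda>x. KL d P (adaptive_conf_estimator d n \<delta> x)
    \<le> ereal (121000 * ((s + s' * ln (exp 1 * real d / s) + ln (real d) * L) / real n)))"
  proof -
    have "exp 1 \<le> real d" using exp_le assms(2) by linarith
    then have "ln (real d) \<ge> 1" using assms(2) by (simp add: ln_ge_iff)
    then show ?thesis
      unfolding adaptive_conf_estimator_def L_def[symmetric] unfolding \<delta>_eq assms(7,8)
      using L \<Lambda>12 ln_log_bound_conf[OF assms(2) _ \<Lambda>12(2)]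
      by (intro prob_KL_add_estimator[where ?\<Lambda>0.0 = \<Lambda>2]) (auto simp: \<Lambda>2_def assms(7,8))
  qed
  ultimately show ?thesis
    unfolding measure_eq_prob_of[OF assms(5,6), symmetric] estimators_restrict L_def by blast
qed

end
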